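(* Let $Q=Q(d,d_0)$ be any compact connected two-point homogeneous space (normalized as in the context). Then the chordal metric $\tau$ and the symmetric difference metric $\theta^{\Delta}(\eta^{\natural},\cdot,\cdot)$ with weight $\eta^{\natural}(r)=\sin r$, $r\in[0,\pi]$, are related by $$\tau(x_1,x_2)=\gamma(Q)\,\theta^{\Delta}(\eta^{\natural},x_1,x_2)\qquad\text{for all }x_1,x_2\in Q,$$ where $$\gamma(Q)=\frac{\langle\tau\rangle}{\langle\theta^{\Delta}(\eta^{\natural})\rangle}=\frac{\operatorname{diam}(Q,\tau)}{\operatorname{diam}(Q,\theta^{\Delta}(\eta^{\natural}))}.$$
   Context: Spaces. $Q=Q(d,d_0)$ is one of the following: the sphere $S^d$, $d\ge 1$, with the convention $d_0=d$; or a projective space $\mathbb{F}P^n$ with $\mathbb F=\mathbb R,\mathbb C,\mathbb H$, $n\ge2$, or the octonionic projective plane $\mathbb{O}P^2$ ($\mathbb F=\mathbb O$, $n=2$), where $d_0=\dim_{\mathbb R}\mathbb F=1,2,4,8$ for $\mathbb F=\mathbb R,\mathbb C,\mathbb H,\mathbb O$ respectively and $d=nd_0$. $Q$ carries the isometry-invariant Riemannian distance $\theta$, rescaled so that $\operatorname{diam}(Q,\theta)=\pi$, and the isometry-invariant Riemannian measure $\mu$ with $\mu(Q)=1$. Concretely, $S^d=\{x\in\mathbb R^{d+1}:\|x\|=1\}$ with $\cos\theta(x_1,x_2)=(x_1,x_2)$; and $\mathbb{F}P^n$ is the set of Hermitian $(n+1)\times(n+1)$ matrices $\Pi$ over $\mathbb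 F$ with $\Pi^2=\Pi$, $\operatorname{Tr}\Pi=1$, with $\sin\frac12\theta(\Pi_1,\Pi_2)=\frac1{\sqrt2}\|\Pi_1-\Pi_2\|$, $0\le\theta\le\pi$, where $\|A\|^2=\sum_{i,j}|a_{ij}|^2$. Chordal metric: $\tau(x_1,x_2)=\sin\frac12\theta(x_1,x_2)$. Balls: $B_r(y)=\{x\in Q:\theta(x,y)<r\}$, $r\in[0,\pi]$. Symmetric difference metrics: $\theta^{\Delta}_r(y_1,y_2)=\frac12\mu\big(B_r(y_1)\Delta B_r(y_2)\big)$, where $\Delta$ is symmetric difference of sets, and, for a non-negative weight function $\eta$ on $[0,\pi]$, $\theta^{\Delta}(\eta,y_1,y_2)=\int_0^\pi\theta^{\Delta}_r(y_1,y_2)\,\eta(r)\,dr$. For a metric $\rho$ on $Q$: $\langle\rho\rangle=\iint_{Q\times Q}\rho(y_1,y_2)\,d\mu(y_1)\,d\mu(y_2)$ and $\operatorname{diam}(Q,\rho)=\sup\{\rho(x_1,x_2):x_1,x_2\in Q\}$. *)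

theory Defs
  imports "HOL-Analysis.Analysis"
begin

section \<open>Quaternions and octonions by Cayley--Dickson doubling\<close>

text \<open>
  The double of an algebra consists of the pairs \<open>(a, b) = a + b l\<close>. The Euclidean norm that
  Isabelle puts on product types is then the usual norm of quaternions and octonions.
\<close>

definition double_mult :: "('a::ab_group_add \<Rightarrow> 'a \<Rightarrow> 'a) \<Rightarrow> ('a \<Rightarrow> 'a) \<Rightarrow> 'a \<times> 'a \<Rightarrow> 'a \<times> 'a \<Rightarrow> 'a \<times> 'a"
  where "double_mult m c x y =
    (m (fst x) (fst y) - m (c (snd y)) (snd x), m (snd y) (fst x) + m (snd x) (c (fst y)))"

definition double_cnj :: "('a::ab_group_add \<Rightarrow> 'a) \<Rightarrow> 'a \<times> 'a \<Rightarrow> 'a \<times> 'a"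
  where "double_cnj c x = (c (fst x), - snd x)"

type_synonym quat = "complex \<times> complex"

definition quat_mult :: "quat \<Rightarrow> quat \<Rightarrow> quat"
  where "quat_mult = double_mult (*) cnj"

definition quat_cnj :: "quat \<Rightarrow> quat"
  where "quat_cnj = double_cnj cnj"

definition quat_one :: quat
  where "quat_one = (1, 0)"

type_synonym oct = "quat \<times> quat"

definition oct_mult :: "oct \<Rightarrow> oct \<Rightarrow> oct"
  where "oct_mult = double_mult quat_mult quat_cnj"

definition oct_cnj :: "oct \<Rightarrow> oct"
  where "oct_cnj = double_cnj quat_cnj"

definition oct_one :: oct
  where "oct_one = (quat_one, 0)"

section \<open>The spaces and their distances\<close>

definition sphere_dist :: "real ^ 'k \<Rightarrow> real ^ 'k \<Rightarrow> real"
  where "sphere_dist x y = arccos (x \<bullet> y)"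

text \<open>
  Hermitian idempotent matrices of trace one, for an algebra given by its multiplication, its
  conjugation and its unit. The size of the matrices is \<open>CARD('n)\<close>, which is \<open>n + 1\<close> for the
  projective space of dimension \<open>n\<close>.
\<close>

definition proj_space ::
  "('f::euclidean_space \<Rightarrow> 'f \<Rightarrow> 'f) \<Rightarrow> ('f \<Rightarrow> 'f) \<Rightarrow> 'f \<Rightarrow> ('f ^ 'n ^ 'n) set"
  where "proj_space m c e =
    {P. (\<forall>i j. P $ i $ j = c (P $ j $ i)) \<and>
        (\<forall>i j. (\<Sum>k\<in>UNIV. m (P $ i $ k) (P $ k $ j)) = P $ i $ j) \<and>
        (\<Sum>i\<in>UNIV. P $ i $ i) = e}"

text \<open>
  The solution in \<open>[0, pi]\<close> of \<open>sin (\<theta> / 2) = norm (P - P') / sqrt 2\<close>; the norm of the matrix type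
  is the Frobenius norm.
\<close>

definition proj_dist :: "'f::euclidean_space ^ 'n ^ 'n \<Rightarrow> 'f ^ 'n ^ 'n \<Rightarrow> real"
  where "proj_dist P P' = 2 * arcsin (norm (P - P') / sqrt 2)"

section \<open>The invariant probability measure\<close>

definition isometry_of :: "'a set \<Rightarrow> ('a \<Rightarrow> 'a \<Rightarrow> real) \<Rightarrow> ('a \<Rightarrow> 'a) \<Rightarrow> bool"
  where "isometry_of Q \<theta> g \<longleftrightarrow>
    bij_betw g Q Q \<and> (\<forall>x\<in>Q. \<forall>y\<in>Q. \<theta> (g x) (g y) = \<theta> x y)"

text \<open>
  On a compact homogeneous space the isometry-invariant Borel probability measure is unique, so for
  the spaces above this singles out the normalized Riemannian measure.
\<close>

definition invariant_prob_measure ::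
  "'a::topological_space set \<Rightarrow> ('a \<Rightarrow> 'a \<Rightarrow> real) \<Rightarrow> 'a measure \<Rightarrow> bool"
  where "invariant_prob_measure Q \<theta> \<mu> \<longleftrightarrow>
    space \<mu> = Q \<and> sets \<mu> = sets (restrict_space borel Q) \<and> emeasure \<mu> Q = 1 \<and>
    (\<forall>g. isometry_of Q \<theta> g \<longrightarrow> (\<forall>A\<in>sets \<mu>. emeasure \<mu> (g ` A) = emeasure \<mu> A))"

section \<open>Chordal and symmetric difference metrics\<close>

definition chordal :: "('a \<Rightarrow> 'a \<Rightarrow> real) \<Rightarrow> 'a \<Rightarrow> 'a \<Rightarrow> real"
  where "chordal \<theta> x y = sin (\<theta> x y / 2)"

definition open_ball :: "'a set \<Rightarrow> ('a \<Rightarrow> 'a \<Rightarrow> real) \<Rightarrow> real \<Rightarrow> 'a \<Rightarrow> 'a set"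
  where "open_ball Q \<theta> r y = {x \<in> Q. \<theta> x y < r}"

definition sym_diff_dist_at ::
  "'a set \<Rightarrow> ('a \<Rightarrow> 'a \<Rightarrow> real) \<Rightarrow> 'a measure \<Rightarrow> real \<Rightarrow> 'a \<Rightarrow> 'a \<Rightarrow> real"
  where "sym_diff_dist_at Q \<theta> \<mu> r y z =
    1 / 2 * measure \<mu> (sym_diff (open_ball Q \<theta> r y) (open_ball Q \<theta> r z))"

definition sym_diff_dist ::
  "'a set \<Rightarrow> ('a \<Rightarrow> 'a \<Rightarrow> real) \<Rightarrow> 'a measure \<Rightarrow> (real \<Rightarrow> real) \<Rightarrow> 'a \<Rightarrow> 'a \<Rightarrow> real"
  where "sym_diff_dist Q \<theta> \<mu> \<eta> y z =
    (LBINT r:{0..pi}. sym_diff_dist_at Q \<theta> \<mu> r y z * \<eta> r)"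

definition mean_dist :: "'a measure \<Rightarrow> ('a \<Rightarrow> 'a \<Rightarrow> real) \<Rightarrow> real"
  where "mean_dist \<mu> \<rho> = (LINT z|(\<mu> \<Otimes>\<^sub>M \<mu>). \<rho> (fst z) (snd z))"

text \<open>The library's \<open>diameter\<close> is tied to \<open>dist\<close>, so it does not apply to other metrics on \<open>Q\<close>.\<close>

definition diam :: "'a set \<Rightarrow> ('a \<Rightarrow> 'a \<Rightarrow> real) \<Rightarrow> real"
  where "diam Q \<rho> = (SUP (x, y)\<in>Q \<times> Q. \<rho> x y)"

text \<open>
  Division by zero is harmless in the following definition: on a space with more than one point
  the first conjunct forces \<open>\<gamma> \<noteq> 0\<close>, hence all denominators are nonzero.
\<close>

definition chordal_proportional_sym_diff ::
  "'a set \<Rightarrow> ('a \<Rightarrow> 'a \<Rightarrow> real) \<Rightarrow> 'a measure \<Rightarrow> (real \<Rightarrow> real) \<Rightarrow> bool"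
  where "chordal_proportional_sym_diff Q \<theta> \<mu> \<eta> \<longleftrightarrow>
    (\<exists>\<gamma>. (\<forall>x\<in>Q. \<forall>y\<in>Q. chordal \<theta> x y = \<gamma> * sym_diff_dist Q \<theta> \<mu> \<eta> x y) \<and>
         \<gamma> = mean_dist \<mu> (chordal \<theta>) / mean_dist \<mu> (sym_diff_dist Q \<theta> \<mu> \<eta>) \<and>
         \<gamma> = diam Q (chordal \<theta>) / diam Q (sym_diff_dist Q \<theta> \<mu> \<eta>))"

end

(*
  Since \<integral> |1[\<theta>(x,z) < r] - 1[\<theta>(y,z) < r]| sin r dr = |cos \<theta>(x,z) - cos \<theta>(y,z)|, Fubini turns
  \<theta>\<^sup>\<Delta>(sin, x, y) into half the integral of |cos \<theta>(x,z) - cos \<theta>(y,z)| over z. In the standard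
  embeddings cos \<theta>(x,z) is an affine function of x \<bullet> z, so this is a multiple of the integral of
  |(x - y) \<bullet> z|. It remains to see that the latter depends on x - y only through its norm, for which
  it suffices that linear symmetries of Q act transitively on the lines spanned by the chords x - y.

  For the projective spaces, a chord is moved to a multiple of E_1 - E_2 (E_k are the diagonal matrix
  units) by two kinds of symmetries of matrices X: real plane rotations, which are available over
  every composition algebra, and X \<mapsto> D X D\<^sup>H with D diagonal unitary, which makes an off-diagonal
  entry real. Over the octonions the latter works for D = diag (u, 1, cnj u).
*)
theory Submission
  imports Defs
begin

section \<open>Embedded homogeneous spaces\<close>

definition linear_symmetry :: "'a::euclidean_space set \<Rightarrow> ('a \<Rightarrow> 'a) \<Rightarrow> bool"
  where "linear_symmetry Q T \<longleftrightarrow> orthogonal_transformation T \<and> T ` Q = Q"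

lemma linear_symmetry_id: "linear_symmetry Q (\<lambda>x. x)"
  by (simp add: linear_symmetry_def)

lemma linear_symmetry_compose:
  "linear_symmetry Q S \<Longrightarrow> linear_symmetry Q T \<Longrightarrow> linear_symmetry Q (S \<circ> T)"
  unfolding linear_symmetry_def
  by (metis image_comp orthogonal_transformation_compose)

lemma linear_symmetry_inv:
  assumes "linear_symmetry Q T"
  shows "linear_symmetry Q (inv T)"
proof -
  have T: "orthogonal_transformation T" "T ` Q = Q"
    using assms by (auto simp: linear_symmetry_def)
  have "inv T ` Q = inv T ` T ` Q"
    using T by simp
  also have "\<dots> = Q"
    using image_inv_f_f [OF orthogonal_transformation_inj [OF T(1)]] .
  finally show ?thesis
    using T by (simp add: linear_symmetry_def orthogonal_transformation_inv)
qed

lemma linear_symmetryI: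
  assumes "orthogonal_transformation T" "\<And>x. x \<in> Q \<Longrightarrow> T x \<in> Q"
    "\<And>x. x \<in> Q \<Longrightarrow> \<exists>y\<in>Q. T y = x"
  shows "linear_symmetry Q T"
  using assms by (force simp: linear_symmetry_def)

text \<open>The radii that separate \<open>\<alpha>\<close> from \<open>\<beta>\<close> form a
  half-open interval, on which \<open>sin\<close> has the primitive \<open>- cos\<close>. The
  absolute value appears because \<open>cos\<close> is decreasing on [0, pi].\<close>

lemma integral_abs_indicator_diff_sin:
  fixes \<alpha> \<beta> :: real
  assumes "\<alpha> \<in> {0..pi}" "\<beta> \<in> {0..pi}"
  shows "(LBINT r:{0..pi}. indicator {r. (\<alpha> < r) \<noteq> (\<beta> < r)} r * sin r) = \<bar>cos \<alpha> - cos \<beta>\<bar>"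
proof -
  have main: "(LBINT r:{0..pi}. indicator {r. (\<alpha> < r) \<noteq> (\<beta> < r)} r * sin r) = cos \<alpha> - cos \<beta>"
    if "0 \<le> \<alpha>" "\<alpha> \<le> \<beta>" "\<beta> \<le> pi" for \<alpha> \<beta> :: real
  proof -
    have "(LBINT r:{0..pi}. indicator {r. (\<alpha> < r) \<noteq> (\<beta> < r)} r * sin r) =
        (LBINT r. indicator {\<alpha><..\<beta>} r *\<^sub>R sin r)"
      unfolding set_lebesgue_integral_def
      using that by (intro Bochner_Integration.integral_cong) (auto simp: indicator_def)
    \<comment> \<open>The added endpoint is a null set; the closed interval is the one for the
      fundamental theorem of calculus.\<close>
    also have "\<dots> = (LBINT r. indicator {\<alpha>..\<beta>} r *\<^sub>R sin r)"
    proof (rule integral_cong_AE)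
      show "AE r in lborel. indicator {\<alpha><..\<beta>} r *\<^sub>R sin r = indicator {\<alpha>..\<beta>} r *\<^sub>R sin r"
        using AE_lborel_singleton [of \<alpha>] by eventually_elim (auto simp: indicator_def)
    qed auto
    also have "\<dots> = (- cos \<beta>) - (- cos \<alpha>)"
      using \<open>\<alpha> \<le> \<beta>\<close>
    proof (rule integral_FTC_Icc)
      show "((\<lambda>r. - cos r) has_vector_derivative sin r) (at r within {\<alpha>..\<beta>})" for r :: real
        unfolding has_real_derivative_iff_has_vector_derivative [symmetric]
        by (auto intro!: derivative_eq_intros)
    qed (intro continuous_intros)
    finally show ?thesis by simp
  qed
  show ?thesis
  proof (cases "\<alpha> \<le> \<beta>")
    case True
    with assms have "cos \<beta> \<le> cos \<alpha>"
      by (intro cos_monotone_0_pi_le) auto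
    with main [of \<alpha> \<beta>] True assms show ?thesis by auto
  next
    case False
    with assms have "cos \<alpha> \<le> cos \<beta>"
      by (intro cos_monotone_0_pi_le) auto
    moreover have "{r. (\<alpha> < r) \<noteq> (\<beta> < r)} = {r. (\<beta> < r) \<noteq> (\<alpha> < r)}"
      by auto
    ultimately show ?thesis
      using main [of \<beta> \<alpha>] False assms by auto
  qed
qed

section \<open>Proportionality for spaces whose chords form one orbit up to scaling\<close>

text \<open>By \<open>cos_\<theta>\<close>, the chordal metric is \<open>\<kappa>\<close> times the
  Euclidean one. The decisive assumption is \<open>transitive_chords\<close>, which ties every chord
  to the single vector \<open>v\<^sub>0\<close>; transitivity on points serves to show that
  \<open>\<mu>\<close> charges nonempty open sets.\<close>

locale embedded_space =
  fixes Q :: "'a::euclidean_space set" and \<theta> :: "'a \<Rightarrow> 'a \<Rightarrow> real" and \<kappa> \<rho> :: real and v\<^sub>0 :: 'a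
    and \<mu> :: "'a measure"
  assumes compact_Q: "compact Q" and not_singleton: "\<exists>x\<in>Q. \<exists>y\<in>Q. x \<noteq> y"
    and norm_Q: "x \<in> Q \<Longrightarrow> norm x = \<rho>"
    and \<kappa>_pos: "\<kappa> > 0"
    and \<theta>_bounds: "x \<in> Q \<Longrightarrow> y \<in> Q \<Longrightarrow> \<theta> x y \<in> {0..pi}"
    and cos_\<theta>: "x \<in> Q \<Longrightarrow> y \<in> Q \<Longrightarrow> cos (\<theta> x y) = 1 - 2 * (\<kappa> * norm (x - y))\<^sup>2"
    and transitive: "x \<in> Q \<Longrightarrow> y \<in> Q \<Longrightarrow> \<exists>T. linear_symmetry Q T \<and> T x = y"
    and transitive_chords: "x \<in> Q \<Longrightarrow> y \<in> Q \<Longrightarrow> \<exists>T s. linear_symmetry Q T \<and> T (x - y) = s *\<^sub>R v\<^sub>0"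
    and invariant: "invariant_prob_measure Q \<theta> \<mu>"
begin

lemma chordal_eq:
  assumes "x \<in> Q" "y \<in> Q"
  shows "chordal \<theta> x y = \<kappa> * norm (x - y)"
proof -
  have "(sin (\<theta> x y / 2))\<^sup>2 = (\<kappa> * norm (x - y))\<^sup>2"
    using cos_\<theta> [OF assms] cos_double_sin [of "\<theta> x y / 2"] by simp
  moreover have "sin (\<theta> x y / 2) \<ge> 0"
    using \<theta>_bounds [OF assms] by (intro sin_ge_zero) auto
  ultimately show ?thesis
    using \<kappa>_pos by (simp add: chordal_def power2_eq_iff_nonneg)
qed

lemma \<theta>_eq: "x \<in> Q \<Longrightarrow> y \<in> Q \<Longrightarrow> \<theta> x y = arccos (1 - 2 * (\<kappa> * norm (x - y))\<^sup>2)"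
  using cos_\<theta> [of x y] \<theta>_bounds [of x y] by (metis arccos_cos atLeastAtMost_iff)

lemma space_\<mu>: "space \<mu> = Q" and sets_\<mu>: "sets \<mu> = sets (restrict_space borel Q)"
  and emeasure_Q: "emeasure \<mu> Q = 1"
  using invariant by (auto simp: invariant_prob_measure_def)

sublocale finite_measure \<mu>
  by standard (simp add: space_\<mu> emeasure_Q)

lemma borel_measurable_\<mu>: "f \<in> borel_measurable borel \<Longrightarrow> f \<in> borel_measurable \<mu>"
  unfolding measurable_cong_sets [OF sets_\<mu> refl] by (rule measurable_restrict_space1)

text \<open>On \<open>Q\<close> the distance \<open>\<theta>\<close> is a function of the Euclidean
  one, so a linear symmetry is one of the isometries under which \<open>\<mu>\<close> is
  invariant.\<close>

lemma emeasure_symmetry: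
  assumes "linear_symmetry Q T" "A \<in> sets \<mu>"
  shows "emeasure \<mu> (T ` A) = emeasure \<mu> A"
proof -
  have T: "orthogonal_transformation T" "T ` Q = Q"
    using assms by (auto simp: linear_symmetry_def)
  have "norm (T x - T y) = norm (x - y)" for x y
    using orthogonal_transformation_norm [OF T(1), of "x - y"]
      linear_diff [OF orthogonal_transformation_linear [OF T(1)], of x y] by simp
  then have "\<theta> (T x) (T y) = \<theta> x y" if "x \<in> Q" "y \<in> Q" for x y
    using that T \<theta>_eq [of "T x" "T y"] \<theta>_eq [of x y] by (auto simp: image_subset_iff set_eq_subset)
  then have "isometry_of Q \<theta> T"
    using T by (auto simp: isometry_of_def bij_betw_def
        intro: inj_on_subset [OF orthogonal_transformation_inj])
  with invariant assms show ?thesis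
    by (auto simp: invariant_prob_measure_def)
qed

lemma measurable_symmetry:
  assumes "linear_symmetry Q T"
  shows "T \<in> measurable \<mu> \<mu>"
proof -
  have T: "linear T" "T ` Q = Q"
    using assms by (auto simp: linear_symmetry_def orthogonal_transformation_linear)
  have "T \<in> measurable (restrict_space borel Q) (restrict_space borel Q)"
    using T
    by (intro measurable_restrict_space3 borel_measurable_continuous_onI linear_continuous_on)
      (auto simp: linear_conv_bounded_linear)
  then show ?thesis
    unfolding measurable_cong_sets [OF sets_\<mu> sets_\<mu>] .
qed

text \<open>Invariance is given for images of sets. As \<open>T\<close> maps \<open>Q\<close> onto
  itself, the image of a preimage is the set itself, which yields the push-forward form that
  integrals need.\<close>

lemma distr_symmetry:
  assumes "linear_symmetry Q T"
  shows "distr \<mu> \<mu> T = \<mu>"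
proof (rule measure_eqI)
  fix A assume "A \<in> sets (distr \<mu> \<mu> T)"
  then have A: "A \<in> sets \<mu>" by simp
  have TQ: "T ` Q = Q" using assms by (simp add: linear_symmetry_def)
  have *: "T -` A \<inter> space \<mu> \<in> sets \<mu>"
    using measurable_symmetry [OF assms] A by (rule measurable_sets)
  have "A \<subseteq> Q" using sets.sets_into_space [OF A] by (simp add: space_\<mu>)
  then have "A \<subseteq> T ` Q" by (simp add: TQ)
  then have "T ` (T -` A \<inter> space \<mu>) = A"
    unfolding space_\<mu> by auto
  then show "emeasure (distr \<mu> \<mu> T) A = emeasure \<mu> A"
    using emeasure_symmetry [OF assms *]
    by (simp add: emeasure_distr measurable_symmetry [OF assms] A)
qed simp

lemma open_Int_sets: "open U \<Longrightarrow> U \<inter> Q \<in> sets \<mu>"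
  unfolding sets_\<mu> sets_restrict_space by (rule image_eqI [where x = U]) (simp_all add: Int_commute)

text \<open>If the set were null, so would be its preimages under symmetries. By transitivity these
  cover \<open>Q\<close>, by compactness finitely many do, and \<open>Q\<close> would be
  null.\<close>

lemma emeasure_open_pos:
  assumes "open U" "x \<in> Q" "x \<in> U"
  shows "emeasure \<mu> (U \<inter> Q) > 0"
proof (rule ccontr)
  assume "\<not> ?thesis"
  then have null: "emeasure \<mu> (U \<inter> Q) = 0" by simp
  have "\<exists>V. open V \<and> y \<in> V \<and> V \<inter> Q \<in> null_sets \<mu>" if y: "y \<in> Q" for y
  proof -
    obtain T where T: "linear_symmetry Q T" "T y = x"
      using transitive [OF y assms(2)] by auto
    have lin: "linear T" and TQ: "T ` Q = Q"
      using T by (auto simp: linear_symmetry_def orthogonal_transformation_linear)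
    have "open (T -` U)"
      using assms(1) lin by (intro open_vimage) (simp_all add: linear_conv_bounded_linear linear_continuous_on)
    moreover have UQ: "U \<inter> Q \<in> sets \<mu>"
      by (rule open_Int_sets) fact
    moreover have "emeasure \<mu> (T -` (U \<inter> Q) \<inter> space \<mu>) = 0"
      using emeasure_distr [OF measurable_symmetry [OF T(1)] UQ]
      unfolding distr_symmetry [OF T(1)] null by (rule sym)
    moreover have "T -` (U \<inter> Q) \<inter> space \<mu> = T -` U \<inter> Q"
      using TQ by (auto simp: space_\<mu>)
    moreover have "T -` (U \<inter> Q) \<inter> space \<mu> \<in> sets \<mu>"
      using measurable_symmetry [OF T(1)] UQ by (rule measurable_sets)
    ultimately show ?thesis
      using T assms y by (intro exI [of _ "T -` U"]) (auto simp: null_sets_def)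
  qed
  then obtain V where V: "open (V y)" "y \<in> V y" "V y \<inter> Q \<in> null_sets \<mu>" if "y \<in> Q" for y
    by metis
  obtain D where D: "D \<subseteq> Q" "finite D" "Q \<subseteq> (\<Union>y\<in>D. V y)"
    by (rule compactE_image [OF compact_Q, of Q V]) (use V in auto)
  have "(\<Union>y\<in>D. V y \<inter> Q) \<in> null_sets \<mu>"
    using D V by (intro null_sets_UN' countable_finite) auto
  moreover have "(\<Union>y\<in>D. V y \<inter> Q) = Q" using D by auto
  ultimately show False using emeasure_Q by (simp add: null_sets_def)
qed

text \<open>The cosine transform of \<open>\<mu>\<close>, which is the support function of a
  zonoid.\<close>

definition width :: "'a \<Rightarrow> real"
  where "width v = (LINT z|\<mu>. \<bar>v \<bullet> z\<bar>)"

lemma width_symmetry: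
  assumes "linear_symmetry Q T"
  shows "width (T v) = width v"
proof -
  have "width (T v) = (LINT z|distr \<mu> \<mu> T. \<bar>T v \<bullet> z\<bar>)"
    by (simp add: width_def distr_symmetry [OF assms])
  also have "\<dots> = (LINT z|\<mu>. \<bar>T v \<bullet> T z\<bar>)"
    by (intro integral_distr measurable_symmetry assms borel_measurable_\<mu>) auto
  also have "\<dots> = width v"
    using assms by (simp add: linear_symmetry_def orthogonal_transformation_def width_def)
  finally show ?thesis .
qed

lemma width_scaleR: "width (s *\<^sub>R v) = \<bar>s\<bar> * width v"
  by (simp add: width_def abs_mult)

text \<open>Both \<open>width\<close> and \<open>norm\<close> are invariant under symmetries and
  absolutely homogeneous, so on a chord they have the same ratio as at \<open>v\<^sub>0\<close>. The
  cross-multiplied form avoids assuming that \<open>v\<^sub>0\<close> is nonzero.\<close>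

lemma width_chord:
  assumes "x \<in> Q" "y \<in> Q"
  shows "width (x - y) * norm v\<^sub>0 = width v\<^sub>0 * norm (x - y)"
proof -
  obtain T s where T: "linear_symmetry Q T" "T (x - y) = s *\<^sub>R v\<^sub>0"
    using transitive_chords [OF assms] by auto
  have "norm (x - y) = \<bar>s\<bar> * norm v\<^sub>0"
    using T by (metis linear_symmetry_def norm_scaleR orthogonal_transformation_norm)
  moreover have "width (x - y) = \<bar>s\<bar> * width v\<^sub>0"
    using width_symmetry [OF T(1), of "x - y"] T(2) by (simp add: width_scaleR)
  ultimately show ?thesis by simp
qed

text \<open>The nonzero vector \<open>x - y\<close> cannot be orthogonal to both \<open>x\<close>
  and \<open>y\<close>. Hence the integrand is nonzero on a nonempty relatively open subset of
  \<open>Q\<close>, which has positive measure.\<close>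

lemma width_chord_pos:
  assumes "x \<in> Q" "y \<in> Q" "x \<noteq> y"
  shows "width (x - y) > 0"
proof -
  let ?U = "{z. (x - y) \<bullet> z \<noteq> 0}"
  have "(x - y) \<bullet> x - (x - y) \<bullet> y \<noteq> 0"
    using assms by (simp add: inner_diff_right [symmetric])
  then have "x \<in> ?U \<or> y \<in> ?U" by auto
  moreover have "open ?U"
    by (intro open_Collect_neq continuous_intros)
  ultimately have pos: "emeasure \<mu> (?U \<inter> Q) > 0"
    using emeasure_open_pos assms by blast
  have int: "integrable \<mu> (\<lambda>z. \<bar>(x - y) \<bullet> z\<bar>)"
  proof (rule integrable_const_bound [of _ "norm (x - y) * \<rho>"])
    show "AE z in \<mu>. norm \<bar>(x - y) \<bullet> z\<bar> \<le> norm (x - y) * \<rho>"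
    proof (rule AE_I2)
      fix z assume "z \<in> space \<mu>"
      then show "norm \<bar>(x - y) \<bullet> z\<bar> \<le> norm (x - y) * \<rho>"
        using Cauchy_Schwarz_ineq2 [of "x - y" z] norm_Q [of z] by (simp add: space_\<mu>)
    qed
  qed (auto intro: borel_measurable_\<mu>)
  have "width (x - y) \<noteq> 0"
  proof
    assume "width (x - y) = 0"
    then have "AE z in \<mu>. \<bar>(x - y) \<bullet> z\<bar> = 0"
      unfolding width_def using integral_nonneg_eq_0_iff_AE [OF int] by simp
    then have "emeasure \<mu> (?U \<inter> Q) = 0"
      using AE_iff_measurable [OF open_Int_sets [OF \<open>open ?U\<close>], of "\<lambda>z. \<bar>(x - y) \<bullet> z\<bar> = 0"]
      by (simp add: space_\<mu> Int_def conj_commute)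
    then show False using pos by simp
  qed
  moreover have "width (x - y) \<ge> 0"
    by (simp add: width_def)
  ultimately show ?thesis by simp
qed


text \<open>Membership in a ball is rewritten as a comparison of cosines, which makes the integrand
  jointly measurable in radius and point. After Fubini the radial integral is elementary.\<close>

lemma sym_diff_dist_eq_width:
  assumes x: "x \<in> Q" and y: "y \<in> Q"
  shows "sym_diff_dist Q \<theta> \<mu> sin x y = 2 * \<kappa>\<^sup>2 * width (x - y)"
proof -
  define N where "N = restrict_space lborel {0..pi}"
  have space_N: "space N = {0..pi}"
    by (simp add: N_def space_restrict_space)
  interpret N: finite_measure N
    by standard (simp add: N_def space_restrict_space emeasure_restrict_space)
  interpret NM: pair_sigma_finite N \<mu> ..
  interpret NM: finite_measure "N \<Otimes>\<^sub>M \<mu>"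
    by (intro finite_measure_pair_measure) unfold_locales
  define S where "S r = sym_diff (open_ball Q \<theta> r x) (open_ball Q \<theta> r y)" for r
  \<comment> \<open>This is the cosine of \<open>\<theta> z x\<close> on \<open>Q\<close>, extended
    to a continuous function of \<open>z\<close> on the whole space.\<close>
  define C where "C x z = 1 - 2 * (\<kappa> * norm (z - x))\<^sup>2" for x z :: 'a
  have lt: "\<theta> z x < r \<longleftrightarrow> cos r < C x z" if "r \<in> {0..pi}" "z \<in> Q" "x \<in> Q" for r x z
    using that \<theta>_bounds [of z x] cos_mono_less_eq [of r "\<theta> z x"]
    by (auto simp: C_def cos_\<theta> [symmetric])
  have mem_S: "z \<in> S r \<longleftrightarrow> (cos r < C x z) \<noteq> (cos r < C y z)"
    if "r \<in> {0..pi}" "z \<in> Q" for r z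
    using that x y by (auto simp: S_def open_ball_def lt)
  define h where "h r z = (if (cos r < C x z) \<noteq> (cos r < C y z) then sin r else 0)" for r z
  have C_meas: "C x \<in> borel_measurable \<mu>" for x
    unfolding C_def by (intro borel_measurable_\<mu>) measurable
  have N_meas: "cos \<in> borel_measurable N" "sin \<in> borel_measurable N"
    unfolding N_def by (auto intro!: measurable_restrict_space1 borel_measurable_continuous_onI continuous_intros)
  note [measurable] = C_meas N_meas
  have h_meas: "case_prod h \<in> borel_measurable (N \<Otimes>\<^sub>M \<mu>)"
    unfolding h_def by measurable
  have h_int: "integrable (N \<Otimes>\<^sub>M \<mu>) (case_prod h)"
    using h_meas by (intro NM.integrable_const_bound [where B = 1] AE_I2) (auto simp: h_def)
  have inner1: "(LINT z|\<mu>. h r z) = measure \<mu> (S r) * sin r" if r: "r \<in> {0..pi}" for r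
  proof -
    have "S r = {z \<in> space \<mu>. (cos r < C x z) \<noteq> (cos r < C y z)}"
      using mem_S [OF r] by (auto simp: space_\<mu> S_def open_ball_def)
    then have "S r \<in> sets \<mu>" by simp
    moreover have "(LINT z|\<mu>. h r z) = (LINT z|\<mu>. indicator (S r) z * sin r)"
      using mem_S [OF r] by (intro Bochner_Integration.integral_cong) (auto simp: h_def space_\<mu>)
    ultimately show ?thesis
      using sets.sets_into_space by (simp add: Int_absorb1)
  qed
  have inner2: "(LINT r|N. h r z) = 4 * \<kappa>\<^sup>2 * \<bar>(x - y) \<bullet> z\<bar>" if z: "z \<in> Q" for z
  proof -
    have "(LINT r|N. h r z) = (LINT r|N. indicator {r. (\<theta> z x < r) \<noteq> (\<theta> z y < r)} r * sin r)"
      using x y z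
      by (intro Bochner_Integration.integral_cong) (auto simp: h_def space_N lt indicator_def)
    also have "\<dots> = (LBINT r:{0..pi}. indicator {r. (\<theta> z x < r) \<noteq> (\<theta> z y < r)} r * sin r)"
      unfolding N_def set_lebesgue_integral_def by (intro integral_restrict_space) auto
    also have "\<dots> = \<bar>cos (\<theta> z x) - cos (\<theta> z y)\<bar>"
      by (intro integral_abs_indicator_diff_sin \<theta>_bounds x y z)
    also have "cos (\<theta> z x) - cos (\<theta> z y) = 2 * \<kappa>\<^sup>2 * ((norm (z - y))\<^sup>2 - (norm (z - x))\<^sup>2)"
      using x y z by (simp add: cos_\<theta> power_mult_distrib algebra_simps)
    \<comment> \<open>The squares of \<open>norm z\<close> cancel here, and the last two terms
      cancel because all points of \<open>Q\<close> have norm \<open>\<rho>\<close>.\<close>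
    also have "(norm (z - y))\<^sup>2 - (norm (z - x))\<^sup>2 = 2 * ((x - y) \<bullet> z) + (norm y)\<^sup>2 - (norm x)\<^sup>2"
      by (simp add: power2_norm_eq_inner inner_diff_left inner_diff_right inner_commute)
    finally show ?thesis
      using norm_Q x y by (simp add: abs_mult)
  qed
  have "sym_diff_dist Q \<theta> \<mu> sin x y = (LINT r|N. 1 / 2 * measure \<mu> (S r) * sin r)"
    unfolding sym_diff_dist_def sym_diff_dist_at_def set_lebesgue_integral_def N_def S_def
    by (intro integral_restrict_space [symmetric]) auto
  also have "\<dots> = (LINT r|N. 1 / 2 * (LINT z|\<mu>. h r z))"
    by (intro Bochner_Integration.integral_cong) (auto simp: inner1 space_N)
  also have "\<dots> = 1 / 2 * (LINT r|N. LINT z|\<mu>. h r z)"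
    by simp
  also have "(LINT r|N. LINT z|\<mu>. h r z) = (LINT z|\<mu>. LINT r|N. h r z)"
    by (rule NM.Fubini_integral [OF h_int, symmetric])
  also have "\<dots> = (LINT z|\<mu>. 4 * \<kappa>\<^sup>2 * \<bar>(x - y) \<bullet> z\<bar>)"
    by (intro Bochner_Integration.integral_cong) (auto simp: inner2 space_\<mu>)
  also have "\<dots> = 4 * \<kappa>\<^sup>2 * width (x - y)"
    by (simp add: width_def)
  finally show ?thesis by simp
qed

text \<open>A vanishing mean would make almost all pairs equal, so \<open>\<mu>\<close> would be
  concentrated at one point \<open>x\<close>. But \<open>Q\<close> without \<open>x\<close> is
  nonempty and relatively open.\<close>

lemma mean_chordal_nonzero: "mean_dist \<mu> (chordal \<theta>) \<noteq> 0"
proof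
  assume *: "mean_dist \<mu> (chordal \<theta>) = 0"
  interpret MM: pair_sigma_finite \<mu> \<mu> ..
  interpret MM: finite_measure "\<mu> \<Otimes>\<^sub>M \<mu>"
    by (intro finite_measure_pair_measure) unfold_locales
  have space: "space (\<mu> \<Otimes>\<^sub>M \<mu>) = Q \<times> Q"
    by (simp add: space_pair_measure space_\<mu>)
  let ?f = "\<lambda>z. \<kappa> * norm (fst z - snd z)"
  have [measurable]: "(\<lambda>z. z) \<in> measurable \<mu> borel"
    by (rule borel_measurable_\<mu>) simp
  have meas: "?f \<in> borel_measurable (\<mu> \<Otimes>\<^sub>M \<mu>)"
    by measurable
  have "norm (x - y) \<le> 2 * \<rho>" if "x \<in> Q" "y \<in> Q" for x y
    using norm_triangle_ineq4 [of x y] that by (simp add: norm_Q)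
  then have int: "integrable (\<mu> \<Otimes>\<^sub>M \<mu>) ?f"
    using \<kappa>_pos meas
    by (intro MM.integrable_const_bound [where B = "\<kappa> * (2 * \<rho>)"] AE_I2) (auto simp: space abs_mult)
  have "(LINT z|(\<mu> \<Otimes>\<^sub>M \<mu>). ?f z) = mean_dist \<mu> (chordal \<theta>)"
    unfolding mean_dist_def
    by (intro Bochner_Integration.integral_cong) (auto simp: space chordal_eq)
  then have "AE z in \<mu> \<Otimes>\<^sub>M \<mu>. ?f z = 0"
    using integral_nonneg_eq_0_iff_AE [OF int] * \<kappa>_pos by simp
  then have "AE z in \<mu> \<Otimes>\<^sub>M \<mu>. fst z = snd z"
    using \<kappa>_pos by simp
  then have ae: "AE x in \<mu>. AE y in \<mu>. x = y"
    by (drule_tac MM.AE_pair) simp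
  \<comment> \<open>As \<open>Q\<close> is not null, what holds almost everywhere holds at some
    point.\<close>
  have "\<exists>x\<in>Q. AE y in \<mu>. x = y"
  proof (rule ccontr)
    assume *: "\<not> ?thesis"
    have "AE x in \<mu>. x \<notin> Q"
      using * by (intro eventually_mono [OF ae]) auto
    then have "emeasure \<mu> Q = 0"
      using AE_iff_measurable [of Q \<mu> "\<lambda>x. x \<notin> Q"] sets.top [of \<mu>] by (auto simp: space_\<mu>)
    then show False by (simp add: emeasure_Q)
  qed
  then obtain x where x: "x \<in> Q" "AE y in \<mu>. x = y" ..
  obtain y where y: "y \<in> Q" "y \<noteq> x"
    using not_singleton by metis
  have "emeasure \<mu> (- {x} \<inter> Q) > 0"
    using y by (intro emeasure_open_pos [of _ y]) auto
  moreover have "- {x} \<inter> Q \<in> sets \<mu>"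
    by (intro open_Int_sets) auto
  moreover have "{y \<in> space \<mu>. x \<noteq> y} = - {x} \<inter> Q"
    by (auto simp: space_\<mu>)
  ultimately show False
    using x(2) AE_iff_measurable [of "- {x} \<inter> Q" \<mu> "\<lambda>y. x = y"] by simp
qed

text \<open>Mean and diameter are homogeneous in the metric, so once the metrics are proportional
  both quotients equal the factor, provided that the denominators are nonzero.\<close>

theorem chordal_proportional: "chordal_proportional_sym_diff Q \<theta> \<mu> sin"
proof -
  obtain a b where ab: "a \<in> Q" "b \<in> Q" "a \<noteq> b"
    using not_singleton by auto
  have v0: "norm v\<^sub>0 > 0" and w0: "width v\<^sub>0 > 0"
  proof -
    obtain T t where T: "linear_symmetry Q T" "T (a - b) = t *\<^sub>R v\<^sub>0"
      using transitive_chords ab by blast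
    then have "norm (t *\<^sub>R v\<^sub>0) = norm (a - b)"
      by (metis linear_symmetry_def orthogonal_transformation_norm)
    with ab show "norm v\<^sub>0 > 0" by auto
    with width_chord_pos [OF ab] width_chord [OF ab(1,2)] ab show "width v\<^sub>0 > 0"
      by (metis mult_pos_pos zero_less_mult_pos2 zero_less_norm_iff right_minus_eq)
  qed
  \<comment> \<open>The quotient of \<open>\<kappa> * norm (x - y)\<close> and
    \<open>2 * \<kappa>\<^sup>2 * width (x - y)\<close>, evaluated by
    \<open>width_chord\<close>.\<close>
  define \<gamma> where "\<gamma> = norm v\<^sub>0 / (2 * \<kappa> * width v\<^sub>0)"
  have \<gamma>: "\<gamma> > 0"
    using v0 w0 \<kappa>_pos by (simp add: \<gamma>_def)
  have eq: "chordal \<theta> x y = \<gamma> * sym_diff_dist Q \<theta> \<mu> sin x y" if "x \<in> Q" "y \<in> Q" for x y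
    using v0 w0 \<kappa>_pos width_chord [OF that] that
    by (simp add: chordal_eq sym_diff_dist_eq_width \<gamma>_def field_simps power2_eq_square)
  have mean: "mean_dist \<mu> (chordal \<theta>) = \<gamma> * mean_dist \<mu> (sym_diff_dist Q \<theta> \<mu> sin)"
  proof -
    have "mean_dist \<mu> (chordal \<theta>) =
        (LINT z|(\<mu> \<Otimes>\<^sub>M \<mu>). \<gamma> * sym_diff_dist Q \<theta> \<mu> sin (fst z) (snd z))"
      unfolding mean_dist_def
      by (intro Bochner_Integration.integral_cong) (auto simp: space_pair_measure space_\<mu> eq)
    then show ?thesis by (simp add: mean_dist_def)
  qed
  let ?s = "\<lambda>p. sym_diff_dist Q \<theta> \<mu> sin (fst p) (snd p)"
  have s_eq: "?s p = chordal \<theta> (fst p) (snd p) / \<gamma>" if "p \<in> Q \<times> Q" for p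
    using that \<gamma> eq by auto
  have s_le: "?s p \<le> 1 / \<gamma>" if "p \<in> Q \<times> Q" for p
    using \<gamma> by (simp add: s_eq [OF that] chordal_def divide_right_mono)
  have bdd: "bdd_above (?s ` (Q \<times> Q))"
    using s_le by (auto intro!: bdd_aboveI2)
  have ne: "Q \<times> Q \<noteq> {}" using ab by auto
  have "0 < ?s (a, b)"
    using s_eq [of "(a, b)"] ab \<gamma> \<kappa>_pos by (simp add: chordal_eq)
  also have "?s (a, b) \<le> (SUP p\<in>Q \<times> Q. ?s p)"
    using ab by (intro cSUP_upper bdd) auto
  finally have pos: "(SUP p\<in>Q \<times> Q. ?s p) > 0" .
  \<comment> \<open>A real supremum commutes with a positive factor when the family is bounded; here
    the chordal metric is at most 1.\<close>
  have "\<gamma> * (SUP p\<in>Q \<times> Q. ?s p) = (SUP p\<in>Q \<times> Q. \<gamma> * ?s p)"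
  proof (rule antisym)
    have bdd': "bdd_above ((\<lambda>p. \<gamma> * ?s p) ` (Q \<times> Q))"
      using s_le \<gamma> by (intro bdd_aboveI2 [where M = 1]) (auto simp: field_simps)
    have "?s p \<le> (SUP p\<in>Q \<times> Q. \<gamma> * ?s p) / \<gamma>" if "p \<in> Q \<times> Q" for p
      using cSUP_upper [OF that bdd'] \<gamma> by (simp add: field_simps)
    then have "(SUP p\<in>Q \<times> Q. ?s p) \<le> (SUP p\<in>Q \<times> Q. \<gamma> * ?s p) / \<gamma>"
      by (intro cSUP_least ne)
    then show "\<gamma> * (SUP p\<in>Q \<times> Q. ?s p) \<le> (SUP p\<in>Q \<times> Q. \<gamma> * ?s p)"
      using \<gamma> by (simp add: field_simps)
    show "(SUP p\<in>Q \<times> Q. \<gamma> * ?s p) \<le> \<gamma> * (SUP p\<in>Q \<times> Q. ?s p)"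
      using cSUP_upper [OF _ bdd] \<gamma> by (intro cSUP_least ne mult_left_mono) auto
  qed
  also have "\<dots> = (SUP p\<in>Q \<times> Q. chordal \<theta> (fst p) (snd p))"
    by (intro SUP_cong refl) (auto simp: eq)
  finally have diam: "diam Q (chordal \<theta>) = \<gamma> * diam Q (sym_diff_dist Q \<theta> \<mu> sin)"
      "diam Q (sym_diff_dist Q \<theta> \<mu> sin) > 0"
    using pos by (auto simp: diam_def case_prod_unfold)
  show ?thesis
    unfolding chordal_proportional_sym_diff_def
    using eq mean mean_chordal_nonzero diam by (intro exI [of _ \<gamma>]) auto
qed

end

section \<open>Composition algebras\<close>

text \<open>Associativity is left out on purpose. The axiom \<open>c_fixed\<close> makes the
  diagonal of a Hermitian matrix real.\<close>

locale composition_algebra =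
  fixes m :: "'f::euclidean_space \<Rightarrow> 'f \<Rightarrow> 'f" and c :: "'f \<Rightarrow> 'f" and e :: 'f
  assumes bilinear_m: "bilinear m" and linear_c: "linear c"
    and c_c [simp]: "c (c x) = x" and c_m: "c (m x y) = m (c y) (c x)"
    and m_e_left [simp]: "m e x = x" and m_e_right [simp]: "m x e = x"
    and norm_m: "norm (m x y) = norm x * norm y"
    and m_c_right [simp]: "m x (c x) = (norm x)\<^sup>2 *\<^sub>R e"
    and c_fixed: "c x = x \<Longrightarrow> \<exists>r. x = r *\<^sub>R e"
    and norm_e [simp]: "norm e = 1"

lemma composition_algebra_real: "composition_algebra (*) id (1::real)"
  by unfold_locales
    (auto simp: bilinear_def linear_iff algebra_simps abs_mult power2_eq_square)

lemma composition_algebra_complex: "composition_algebra (*) cnj 1"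
proof
  show "\<exists>r. x = r *\<^sub>R 1" if "cnj x = x" for x
    using that by (metis Reals_cnj_iff Reals_cases of_real_def)
qed (auto simp: bilinear_def linear_iff algebra_simps norm_mult complex_norm_square scaleR_conv_of_real
      simp flip: of_real_power)

lemmas oct_unfold = oct_mult_def quat_mult_def oct_cnj_def quat_cnj_def double_mult_def
  double_cnj_def oct_one_def quat_one_def

lemma norm_prod_power2: "(norm x)\<^sup>2 = (norm (fst x))\<^sup>2 + (norm (snd x))\<^sup>2"
  by (simp add: norm_prod_def)

lemma norm_power2_quat: "complex_of_real ((norm (x::quat))\<^sup>2) =
  fst x * cnj (fst x) + snd x * cnj (snd x)"
  by (simp add: norm_prod_power2 complex_norm_square del: of_real_power)

lemma norm_power2_oct: "complex_of_real ((norm (x::oct))\<^sup>2) =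
  fst (fst x) * cnj (fst (fst x)) + snd (fst x) * cnj (snd (fst x)) +
  fst (snd x) * cnj (fst (snd x)) + snd (snd x) * cnj (snd (snd x))"
  by (simp add: norm_prod_power2 complex_norm_square del: of_real_power)

text \<open>This is the eight-square identity. Inside the complex numbers a squared modulus is
  \<open>z * cnj z\<close>, so the claim becomes a polynomial identity in complex coordinates and
  their conjugates.\<close>

lemma norm_mult_oct: "norm (oct_mult x y) = norm x * norm y"
proof -
  have "complex_of_real ((norm (oct_mult x y))\<^sup>2) =
      complex_of_real ((norm x)\<^sup>2) * complex_of_real ((norm y)\<^sup>2)"
    unfolding norm_power2_oct by (simp add: oct_unfold algebra_simps)
  then have "(norm (oct_mult x y))\<^sup>2 = (norm x * norm y)\<^sup>2"
    unfolding power_mult_distrib of_real_mult [symmetric] of_real_eq_iff .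
  then show ?thesis
    by (simp add: power2_eq_iff_nonneg)
qed

lemma norm_mult_quat: "norm (quat_mult x y) = norm x * norm y"
proof -
  have "complex_of_real ((norm (quat_mult x y))\<^sup>2) =
      complex_of_real ((norm x)\<^sup>2) * complex_of_real ((norm y)\<^sup>2)"
    unfolding norm_power2_quat by (simp add: oct_unfold algebra_simps)
  then have "(norm (quat_mult x y))\<^sup>2 = (norm x * norm y)\<^sup>2"
    unfolding power_mult_distrib of_real_mult [symmetric] of_real_eq_iff .
  then show ?thesis
    by (simp add: power2_eq_iff_nonneg)
qed

lemma cnj_fixed: "cnj z = z \<Longrightarrow> \<exists>r. z = complex_of_real r"
  by (metis Reals_cnj_iff Reals_cases)

lemma neg_fixed: "- (z::complex) = z \<Longrightarrow> z = 0"
  by (simp add: neg_eq_iff_add_eq_0 flip: mult_2)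

lemma composition_algebra_quat: "composition_algebra quat_mult quat_cnj quat_one"
proof
  show "quat_mult x (quat_cnj x) = (norm x)\<^sup>2 *\<^sub>R quat_one" for x
  proof -
    have "(norm x)\<^sup>2 *\<^sub>R quat_one = (complex_of_real ((norm x)\<^sup>2), 0)"
      by (simp add: quat_one_def scaleR_conv_of_real)
    then show ?thesis
      unfolding norm_power2_quat by (simp add: oct_unfold algebra_simps)
  qed
  show "\<exists>r. x = r *\<^sub>R quat_one" if "quat_cnj x = x" for x
    using that cnj_fixed [of "fst x"] neg_fixed [of "snd x"]
    by (cases x) (auto simp: oct_unfold scaleR_conv_of_real)
  show "norm (quat_mult x y) = norm x * norm y" for x y
    by (rule norm_mult_quat)
  show "norm quat_one = 1"
    by (simp add: oct_unfold norm_prod_def)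
qed (auto simp: oct_unfold bilinear_def linear_iff algebra_simps prod_eq_iff)

lemma composition_algebra_oct: "composition_algebra oct_mult oct_cnj oct_one"
proof
  show "oct_mult x (oct_cnj x) = (norm x)\<^sup>2 *\<^sub>R oct_one" for x
  proof -
    have "(norm x)\<^sup>2 *\<^sub>R oct_one = ((complex_of_real ((norm x)\<^sup>2), 0), 0)"
      by (simp add: oct_one_def quat_one_def scaleR_conv_of_real zero_prod_def)
    then show ?thesis
      unfolding norm_power2_oct by (simp add: oct_unfold algebra_simps zero_prod_def)
  qed
  show "\<exists>r. x = r *\<^sub>R oct_one" if "oct_cnj x = x" for x
    using that cnj_fixed [of "fst (fst x)"] neg_fixed
    by (cases x) (auto simp: oct_unfold scaleR_conv_of_real zero_prod_def)
  show "norm (oct_mult x y) = norm x * norm y" for x y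
    by (rule norm_mult_oct)
  show "norm oct_one = 1"
    by (simp add: oct_unfold norm_prod_def)
qed (auto simp: oct_unfold bilinear_def linear_iff algebra_simps prod_eq_iff)

lemma quat_assoc: "quat_mult (quat_mult x y) z = quat_mult x (quat_mult y z)"
  by (simp add: oct_unfold algebra_simps)


section \<open>Symmetries of projective spaces\<close>

lemma cos_times_cos: "cos t * cos t = 1 - sin t * sin (t::real)"
  by (metis cos_squared_eq power2_eq_square)

lemma cos_sin_scaleR: "cos t *\<^sub>R cos t *\<^sub>R x + sin t *\<^sub>R sin t *\<^sub>R x = (x :: 'v::real_vector)"
  by (metis scaleR_scaleR scaleR_add_left scaleR_one power2_eq_square sin_cos_squared_add2)

definition rot :: "'n \<Rightarrow> 'n \<Rightarrow> real \<Rightarrow> ('n \<Rightarrow> 'v::real_vector) \<Rightarrow> 'n \<Rightarrow> 'v"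
  where "rot i j t v k =
    (if k = i then cos t *\<^sub>R v i + sin t *\<^sub>R v j
     else if k = j then cos t *\<^sub>R v j - sin t *\<^sub>R v i else v k)"

lemma rot_rot_minus:
  assumes "i \<noteq> j"
  shows "rot i j t (rot i j (- t) v) = v"
proof
  fix k
  show "rot i j t (rot i j (- t) v) k = v k"
    using assms cos_sin_scaleR [of t "v i"] cos_sin_scaleR [of t "v j"] by (simp add: rot_def algebra_simps)
qed

lemma rot_linear: "linear h \<Longrightarrow> h (rot i j t v k) = rot i j t (\<lambda>k. h (v k)) k"
  by (simp add: rot_def linear_add linear_diff linear_scale)

text \<open>Rotations of rows and of columns commute because their coefficients are real; this
  replaces associativity in R X R^T.\<close>

lemma rot_rot_commute:
  "rot i j t (\<lambda>a. rot i' j' t' (\<lambda>b. X a b) q) p = rot i' j' t' (\<lambda>b. rot i j t (\<lambda>a. X a b) p) q"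
  by (simp add: rot_def algebra_simps)

lemma rot_add: "rot i j t (\<lambda>k. v k + w k) k = rot i j t v k + rot i j t w k"
  and rot_scaleR: "rot i j t (\<lambda>k. r *\<^sub>R v k) k = r *\<^sub>R rot i j t v k"
  by (simp_all add: rot_def algebra_simps)

lemma sum_split2:
  fixes f :: "'n::finite \<Rightarrow> 'v::comm_monoid_add"
  assumes "i \<noteq> j"
  shows "(\<Sum>k\<in>UNIV. f k) = f i + f j + (\<Sum>k\<in>- {i, j}. f k)"
proof -
  have "(UNIV :: 'n set) = insert i (insert j (- {i, j}))" by auto
  then have "(\<Sum>k\<in>UNIV. f k) = (\<Sum>k\<in>insert i (insert j (- {i, j})). f k)" by simp
  then show ?thesis using assms by (simp add: add.assoc)
qed

text \<open>The mixed terms cancel and the squares add up to one, which is R^T R = 1. With the inner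
  product for \<open>B\<close> it gives invariance of norms, with the multiplication of the algebra
  it removes R^T R from within a matrix product.\<close>

lemma sum_bilinear_rot:
  fixes v w :: "'n::finite \<Rightarrow> 'v::real_vector" and B :: "'v \<Rightarrow> 'v \<Rightarrow> 'w::real_vector"
  assumes B: "bilinear B" and "i \<noteq> j"
  shows "(\<Sum>k\<in>UNIV. B (rot i j t v k) (rot i j t w k)) = (\<Sum>k\<in>UNIV. B (v k) (w k))"
proof -
  show ?thesis
    unfolding sum_split2 [OF assms(2)]
    using assms(2)
    by (simp add: rot_def cos_times_cos bilinear_ladd [OF B] bilinear_radd [OF B] bilinear_lsub [OF B]
        bilinear_rsub [OF B] bilinear_lmul [OF B] bilinear_rmul [OF B] algebra_simps)
qed

text \<open>This is X \<mapsto> R X R^T, with R the real rotation matrix, for entries in any real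
  vector space.\<close>

definition conj_rot :: "'n \<Rightarrow> 'n \<Rightarrow> real \<Rightarrow> 'v::real_vector ^ 'n ^ 'n \<Rightarrow> 'v ^ 'n ^ 'n"
  where "conj_rot i j t X = (\<chi> p q. rot i j t (\<lambda>a. rot i j t (\<lambda>b. X $ a $ b) q) p)"

lemma conj_rot_nth_rows: "conj_rot i j t X $ p $ q = rot i j t (\<lambda>a. rot i j t (\<lambda>b. X $ a $ b) q) p"
  by (simp add: conj_rot_def)

lemma conj_rot_nth_columns: "conj_rot i j t X $ p $ q = rot i j t (\<lambda>b. rot i j t (\<lambda>a. X $ a $ b) p) q"
  unfolding conj_rot_nth_rows by (rule rot_rot_commute)

lemma norm_matrix_power2:
  fixes X :: "'v::real_inner ^ 'n ^ 'm"
  shows "(norm X)\<^sup>2 = (\<Sum>i\<in>UNIV. \<Sum>j\<in>UNIV. (norm (X $ i $ j))\<^sup>2)"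
  by (simp add: power2_norm_eq_inner inner_vec_def)

text \<open>A rotation preserves the sum of squares of each row, and after exchanging the sums of
  each column.\<close>

lemma orthogonal_transformation_conj_rot:
  assumes "i \<noteq> j"
  shows "orthogonal_transformation (conj_rot i j t :: 'v::euclidean_space ^ 'n::finite ^ 'n \<Rightarrow> _)"
  unfolding orthogonal_transformation
proof
  have sq: "(\<Sum>k\<in>UNIV. (norm (rot i j t v k))\<^sup>2) = (\<Sum>k\<in>UNIV. (norm (v k))\<^sup>2)"
    for v :: "'n \<Rightarrow> 'v"
    unfolding power2_norm_eq_inner
    by (rule sum_bilinear_rot [OF _ assms])
      (simp add: bilinear_conv_bounded_bilinear bounded_bilinear_inner)
  show "linear (conj_rot i j t :: 'v ^ 'n ^ 'n \<Rightarrow> _)"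
    by (simp add: linear_iff conj_rot_def vec_eq_iff rot_add rot_scaleR)
  show "\<forall>X :: 'v ^ 'n ^ 'n. norm (conj_rot i j t X) = norm X"
  proof
    fix X :: "'v ^ 'n ^ 'n"
    have "(norm (conj_rot i j t X))\<^sup>2 =
        (\<Sum>p\<in>UNIV. \<Sum>q\<in>UNIV. (norm (rot i j t (\<lambda>b. rot i j t (\<lambda>a. X $ a $ b) p) q))\<^sup>2)"
      by (simp only: norm_matrix_power2 conj_rot_nth_columns)
    also have "\<dots> = (\<Sum>p\<in>UNIV. \<Sum>b\<in>UNIV. (norm (rot i j t (\<lambda>a. X $ a $ b) p))\<^sup>2)"
      by (simp add: sq)
    also have "\<dots> = (\<Sum>b\<in>UNIV. \<Sum>p\<in>UNIV. (norm (rot i j t (\<lambda>a. X $ a $ b) p))\<^sup>2)"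
      by (rule sum.swap)
    also have "\<dots> = (\<Sum>b\<in>UNIV. \<Sum>a\<in>UNIV. (norm (X $ a $ b))\<^sup>2)"
      by (simp add: sq)
    also have "\<dots> = (norm X)\<^sup>2"
      unfolding norm_matrix_power2 by (rule sum.swap)
    finally show "norm (conj_rot i j t X) = norm X"
      by (simp add: power2_eq_iff_nonneg)
  qed
qed

lemma conj_rot_conj_rot_minus:
  assumes "i \<noteq> j"
  shows "conj_rot i j t (conj_rot i j (- t) X) = X"
proof -
  \<comment> \<open>Exchanging the two middle rotations brings the opposite ones on the same index
    together.\<close>
  have "rot i j t (\<lambda>b. rot i j (- t) (\<lambda>a. rot i j (- t) (\<lambda>b. X $ a $ b) b) a) q =
      rot i j (- t) (\<lambda>a. rot i j t (rot i j (- t) (\<lambda>b. X $ a $ b)) q) a" for a q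
    by (rule rot_rot_commute)
  then show ?thesis
    by (simp add: conj_rot_def vec_eq_iff rot_rot_minus [OF assms])
qed

text \<open>The unit vector (cos t, sin t) is taken along (b, -a).\<close>

lemma ex_angle: "\<exists>t. a * cos t + b * sin t = (0::real)"
proof (cases "a = 0 \<and> b = 0")
  case False
  define s where "s = sqrt (a\<^sup>2 + b\<^sup>2)"
  have "a\<^sup>2 + b\<^sup>2 > 0" using False by (simp add: sum_power2_gt_zero_iff)
  then have s: "s > 0" "s\<^sup>2 = a\<^sup>2 + b\<^sup>2" by (simp_all add: s_def)
  then have "(b / s)\<^sup>2 + (- a / s)\<^sup>2 = 1"
    using False by (simp add: power_divide add_divide_distrib [symmetric] add.commute)
  then obtain t where "b / s = cos t" "- a / s = sin t"
    using sincos_total_2pi by metis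
  then have "a * cos t + b * sin t = a * (b / s) + b * (- a / s)" by simp
  then show ?thesis by auto
qed auto

section \<open>Structure of the points of a projective space\<close>

context composition_algebra
begin

lemmas m_simps = bilinear_ladd [OF bilinear_m] bilinear_radd [OF bilinear_m]
  bilinear_lmul [OF bilinear_m] bilinear_rmul [OF bilinear_m]
  bilinear_lzero [OF bilinear_m] bilinear_rzero [OF bilinear_m]

lemma c_simps: "c (x + y) = c x + c y" "c (r *\<^sub>R x) = r *\<^sub>R c x" "c 0 = 0"
  using linear_c by (simp_all add: linear_add linear_scale linear_0)

lemma e_nonzero [simp]: "e \<noteq> 0"
  using norm_e by (metis norm_zero zero_neq_one)

lemma inner_e_e [simp]: "e \<bullet> e = 1"
  by (simp add: dot_square_norm)

lemma c_e [simp]: "c e = e"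
  by (metis m_c_right m_e_left norm_e power_one scaleR_one)

lemma norm_c [simp]: "norm (c x) = norm x"
proof (cases "x = 0")
  case False
  have "norm (m x (c x)) = (norm x)\<^sup>2" by simp
  then show ?thesis unfolding norm_m using False by (simp add: power2_eq_square)
qed (simp add: c_simps)

lemma m_c_left [simp]: "m (c x) x = (norm x)\<^sup>2 *\<^sub>R e"
  using m_c_right [of "c x"] by simp

text \<open>Diagonal entries of points are real multiples of the unit vector \<open>e\<close>, and
  the inner product extracts the coefficient.\<close>

definition diag_entry :: "'f ^ 'n ^ 'n \<Rightarrow> 'n \<Rightarrow> real"
  where "diag_entry X i = X $ i $ i \<bullet> e"

definition coord_point :: "'n \<Rightarrow> 'f ^ 'n ^ 'n"
  where "coord_point k = (\<chi> a b. if a = k \<and> b = k then e else 0)"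

lemma hermitian: "X \<in> proj_space m c e \<Longrightarrow> X $ i $ j = c (X $ j $ i)"
  and idempotent: "X \<in> proj_space m c e \<Longrightarrow> (\<Sum>k\<in>UNIV. m (X $ i $ k) (X $ k $ j)) = X $ i $ j"
  and trace: "X \<in> proj_space m c e \<Longrightarrow> (\<Sum>i\<in>UNIV. X $ i $ i) = e"
  unfolding proj_space_def by blast+

lemma diagonal:
  assumes "X \<in> proj_space m c e"
  shows "X $ i $ i = diag_entry X i *\<^sub>R e"
proof -
  obtain r where "X $ i $ i = r *\<^sub>R e"
    using c_fixed hermitian [OF assms, of i i] by metis
  then show ?thesis by (simp add: diag_entry_def)
qed

text \<open>Compare the diagonals in X X = X, where X is Hermitian.\<close>

lemma diag_entry_eq:
  assumes "X \<in> proj_space m c e"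
  shows "diag_entry X i = (\<Sum>k\<in>UNIV. (norm (X $ i $ k))\<^sup>2)"
proof -
  have "m (X $ i $ k) (X $ k $ i) = (norm (X $ i $ k))\<^sup>2 *\<^sub>R e" for k
    by (subst hermitian [OF assms, of k i]) simp
  then have "(\<Sum>k\<in>UNIV. (norm (X $ i $ k))\<^sup>2) *\<^sub>R e = diag_entry X i *\<^sub>R e"
    using idempotent [OF assms, of i i] diagonal [OF assms, of i]
    by (simp add: scaleR_sum_left)
  then show ?thesis by simp
qed

lemma diag_entry_nonneg: "X \<in> proj_space m c e \<Longrightarrow> diag_entry X i \<ge> 0"
  by (simp add: diag_entry_eq sum_nonneg)

lemma sum_diag_entry:
  assumes "X \<in> proj_space m c e"
  shows "(\<Sum>i\<in>UNIV. diag_entry X i) = 1"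
  using arg_cong [OF trace [OF assms], of "\<lambda>x. x \<bullet> e"]
  by (simp add: diag_entry_def inner_sum_left)

text \<open>By \<open>diag_entry_eq\<close> the squared norm is the trace.\<close>

lemma norm_proj_space:
  assumes "X \<in> proj_space m c e"
  shows "norm X = 1"
proof -
  have "(norm X)\<^sup>2 = 1"
    unfolding norm_matrix_power2 using assms by (simp add: sum_diag_entry flip: diag_entry_eq)
  then show ?thesis
    by (simp add: power2_eq_1_iff) (metis norm_ge_zero neg_0_le_iff_le not_one_le_zero)
qed

text \<open>
  Cauchy--Schwarz bounds every \<open>2 \<times> 2\<close> minor below by zero, and the minors add up to
  \<open>(trace X)\<^sup>2 - (norm X)\<^sup>2 = 0\<close>. This expresses that \<open>X\<close> has rank one without using
  associativity.
\<close>

lemma norm_entry: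
  assumes X: "X \<in> proj_space m c e"
  shows "(norm (X $ i $ j))\<^sup>2 = diag_entry X i * diag_entry X j"
proof -
  have le: "(norm (X $ i $ j))\<^sup>2 \<le> diag_entry X i * diag_entry X j" for i j
  proof -
    have "norm (X $ i $ j) = norm (\<Sum>k\<in>UNIV. m (X $ i $ k) (X $ k $ j))"
      by (simp add: idempotent [OF X])
    also have "\<dots> \<le> (\<Sum>k\<in>UNIV. norm (X $ i $ k) * norm (X $ j $ k))"
    proof (rule sum_norm_le)
      show "norm (m (X $ i $ k) (X $ k $ j)) \<le> norm (X $ i $ k) * norm (X $ j $ k)" for k
        by (subst hermitian [OF X, of k j]) (simp add: norm_m)
    qed
    finally have "(norm (X $ i $ j))\<^sup>2 \<le> (\<Sum>k\<in>UNIV. norm (X $ i $ k) * norm (X $ j $ k))\<^sup>2"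
      by (intro power_mono) auto
    also have "\<dots> \<le> (\<Sum>k\<in>UNIV. (norm (X $ i $ k))\<^sup>2) * (\<Sum>k\<in>UNIV. (norm (X $ j $ k))\<^sup>2)"
      by (rule Cauchy_Schwarz_ineq_sum)
    finally show ?thesis by (simp add: diag_entry_eq [OF X])
  qed
  define D where "D p = diag_entry X (fst p) * diag_entry X (snd p) - (norm (X $ fst p $ snd p))\<^sup>2" for p
  have "sum D (UNIV \<times> UNIV) =
      (\<Sum>i\<in>UNIV. \<Sum>j\<in>UNIV. diag_entry X i * diag_entry X j - (norm (X $ i $ j))\<^sup>2)"
    by (simp add: D_def sum.cartesian_product case_prod_unfold)
  also have "\<dots> = (\<Sum>i\<in>UNIV. diag_entry X i) * (\<Sum>j\<in>UNIV. diag_entry X j) - (norm X)\<^sup>2"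
    by (simp add: sum_subtractf sum_product norm_matrix_power2)
  also have "\<dots> = 0"
    by (simp add: sum_diag_entry [OF X] norm_proj_space [OF X])
  finally have "\<forall>p\<in>UNIV \<times> UNIV. D p = 0"
    using le by (subst (asm) sum_nonneg_eq_0_iff) (auto simp: D_def)
  then show ?thesis by (auto simp: D_def)
qed

lemma entry_eq_0:
  assumes "X \<in> proj_space m c e" "diag_entry X i = 0 \<or> diag_entry X j = 0"
  shows "X $ i $ j = 0"
  using norm_entry [OF assms(1), of i j] assms(2) by auto

text \<open>The trace forces the remaining diagonal entry to be 1, and a zero on the diagonal clears
  its row and column.\<close>

lemma coord_pointI:
  assumes "X \<in> proj_space m c e" "\<And>k. k \<noteq> i \<Longrightarrow> diag_entry X k = 0"
  shows "X = coord_point i"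
proof -
  have "(\<Sum>k\<in>UNIV. diag_entry X k) = (\<Sum>k\<in>{i}. diag_entry X k)"
    using assms(2) by (intro sum.mono_neutral_right) auto
  then have "diag_entry X i = 1"
    using sum_diag_entry [OF assms(1)] by simp
  then show ?thesis
    using assms entry_eq_0 [OF assms(1)] diagonal [OF assms(1), of i]
    by (auto simp: vec_eq_iff coord_point_def)
qed

lemma inner_coord_point: "coord_point i \<bullet> X = diag_entry X i"
proof -
  have "coord_point i \<bullet> X = (\<Sum>a\<in>UNIV. \<Sum>b\<in>UNIV. if b = i then (if a = i then e \<bullet> X $ i $ i else 0) else 0)"
    unfolding inner_vec_def by (intro sum.cong refl) (auto simp: coord_point_def)
  then show ?thesis by (simp add: diag_entry_def inner_commute)
qed

lemma coord_point_in_proj_space: "coord_point i \<in> proj_space m c e"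
proof -
  have "m (if a = i \<and> k = i then e else 0) (if k = i \<and> b = i then e else 0) =
     (if k = i then (if a = i \<and> b = i then e else 0) else 0)" for a b k
    by (auto simp: m_simps)
  then show ?thesis
    by (auto simp: proj_space_def coord_point_def c_simps)
qed

lemma compact_proj_space: "compact (proj_space m c e :: ('f ^ 'n::finite ^ 'n) set)"
proof -
  have bil: "bounded_bilinear m"
    using bilinear_m by (simp add: bilinear_conv_bounded_bilinear)
  have lin: "bounded_linear c"
    using linear_c by (simp add: linear_conv_bounded_linear)
  have "closed (proj_space m c e :: ('f ^ 'n ^ 'n) set)"
    unfolding proj_space_def
    by (intro closed_Collect_conj closed_Collect_all closed_Collect_eq continuous_intros
        bounded_bilinear.continuous_on [OF bil] bounded_linear.continuous_on [OF lin])
  moreover have "bounded (proj_space m c e :: ('f ^ 'n ^ 'n) set)"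
    by (auto simp: bounded_iff norm_proj_space intro!: exI [of _ 1])
  ultimately show ?thesis by (simp add: compact_eq_bounded_closed)
qed

section \<open>Plane rotations as symmetries of projective spaces\<close>

text \<open>In (R X R^T) (R X R^T) the middle R^T R drops out by \<open>sum_bilinear_rot\<close>;
  the outer rotations pass through the bilinear product since they are real.\<close>

lemma conj_rot_in_proj_space:
  fixes X :: "'f ^ 'n::finite ^ 'n"
  assumes X: "X \<in> proj_space m c e" and ij: "i \<noteq> j"
  shows "conj_rot i j t X \<in> proj_space m c e"
proof -
  let ?r = "rot i j t"
  have lin: "linear (m x)" "linear (\<lambda>x. m x y)" for x y
    using bilinear_m by (auto simp: bilinear_def)
  have herm: "conj_rot i j t X $ p $ q = c (conj_rot i j t X $ q $ p)" for p q
    unfolding conj_rot_nth_rows [of i j t X p q] conj_rot_nth_columns [of i j t X q p]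
    by (simp add: rot_linear [OF linear_c] hermitian [OF X, symmetric])
  have idem: "(\<Sum>k\<in>UNIV. m (conj_rot i j t X $ p $ k) (conj_rot i j t X $ k $ q)) =
      conj_rot i j t X $ p $ q" for p q
  proof -
    \<comment> \<open>The column form for the left factor and the row form for the right one put the
      rotation of the summation index outermost in both.\<close>
    have "(\<Sum>k\<in>UNIV. m (conj_rot i j t X $ p $ k) (conj_rot i j t X $ k $ q)) =
        (\<Sum>k\<in>UNIV. m (?r (\<lambda>k. ?r (\<lambda>a. X $ a $ k) p) k) (?r (\<lambda>k. ?r (\<lambda>b. X $ k $ b) q) k))"
      unfolding conj_rot_nth_rows [of i j t X _ q] conj_rot_nth_columns [of i j t X p] ..
    also have "\<dots> = (\<Sum>k\<in>UNIV. m (?r (\<lambda>a. X $ a $ k) p) (?r (\<lambda>b. X $ k $ b) q))"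
      by (rule sum_bilinear_rot [OF bilinear_m ij])
    also have "\<dots> = (\<Sum>k\<in>UNIV. ?r (\<lambda>a. ?r (\<lambda>b. m (X $ a $ k) (X $ k $ b)) q) p)"
      by (simp add: rot_linear [OF lin(1)] rot_linear [OF lin(2)])
        (intro sum.cong refl rot_rot_commute)
    also have "\<dots> = ?r (\<lambda>a. ?r (\<lambda>b. \<Sum>k\<in>UNIV. m (X $ a $ k) (X $ k $ b)) q) p"
      by (simp add: rot_def sum.distrib sum_subtractf scaleR_sum_right [symmetric])
    finally show ?thesis by (simp add: idempotent [OF X] conj_rot_def)
  qed
  have "(\<Sum>k\<in>UNIV. conj_rot i j t X $ k $ k) = (\<Sum>k\<in>UNIV. X $ k $ k)"
    unfolding sum_split2 [OF ij] using ij
    by (simp add: conj_rot_def rot_def cos_times_cos algebra_simps)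
  then have "(\<Sum>k\<in>UNIV. conj_rot i j t X $ k $ k) = e"
    using trace [OF X] by simp
  then show ?thesis
    unfolding proj_space_def by (intro CollectI conjI allI herm idem)
qed

lemma linear_symmetry_conj_rot:
  fixes i j :: "'n::finite"
  assumes "i \<noteq> j"
  shows "linear_symmetry (proj_space m c e :: ('f ^ 'n ^ 'n) set) (conj_rot i j t)"
  using conj_rot_in_proj_space [OF _ assms] conj_rot_conj_rot_minus [OF assms]
  by (intro linear_symmetryI orthogonal_transformation_conj_rot [OF assms]) blast+

lemma conj_rot_coord_point:
  assumes "k \<noteq> i" "k \<noteq> j"
  shows "conj_rot i j t (coord_point k) = coord_point k"
  using assms by (auto simp: conj_rot_def coord_point_def rot_def vec_eq_iff)

text \<open>The block of \<open>X\<close> at \<open>i\<close>, \<open>j\<close> is a real symmetric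
  matrix, singular by \<open>norm_entry\<close>, so some rotation moves its kernel to the j-th
  axis.\<close>

lemma ex_conj_rot_diag_entry_0:
  fixes X :: "'f ^ 'n::finite ^ 'n"
  assumes X: "X \<in> proj_space m c e" and ij: "i \<noteq> j" and r: "X $ i $ j = r *\<^sub>R e"
  shows "\<exists>t. diag_entry (conj_rot i j t X) j = 0"
proof -
  define p q where "p = diag_entry X i" and "q = diag_entry X j"
  have pq: "r\<^sup>2 = p * q"
    using norm_entry [OF X, of i j] r by (simp add: p_def q_def)
  have r': "X $ j $ i = r *\<^sub>R e"
    using hermitian [OF X, of j i] r by (simp add: c_simps)
  have "conj_rot i j t X $ j $ j =
      ((cos t)\<^sup>2 * q - 2 * cos t * sin t * r + (sin t)\<^sup>2 * p) *\<^sub>R e" for t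
    using ij r r' diagonal [OF X, of i] diagonal [OF X, of j]
    by (simp add: conj_rot_def rot_def p_def [symmetric] q_def [symmetric] power2_eq_square
        algebra_simps flip: scaleR_2)
  then have eq: "diag_entry (conj_rot i j t X) j =
      (cos t)\<^sup>2 * q - 2 * cos t * sin t * r + (sin t)\<^sup>2 * p" for t
    by (simp add: diag_entry_def)
  show ?thesis
  proof (cases "q = 0")
    case True
    then show ?thesis using eq [of 0] by auto
  next
    case False
    obtain t where t: "q * cos t + (- r) * sin t = 0"
      using ex_angle by blast
    \<comment> \<open>Because \<open>r\<^sup>2 = p * q\<close>, multiplication by \<open>q\<close>
      completes the square.\<close>
    have "q * ((cos t)\<^sup>2 * q - 2 * cos t * sin t * r + (sin t)\<^sup>2 * p) = (q * cos t + (- r) * sin t)\<^sup>2"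
      using pq by (simp add: power2_eq_square algebra_simps)
    with t False have "diag_entry (conj_rot i j t X) j = 0"
      unfolding eq by (metis mult_eq_0_iff power_zero_numeral)
    then show ?thesis ..
  qed
qed

text \<open>On real symmetric 2 x 2 blocks of trace zero, conjugation by a rotation turns the pair
  (q, r) by the doubled angle, so the off-diagonal part can be turned away.\<close>

lemma ex_conj_rot_diagonal:
  fixes A :: "'f ^ 'n::finite ^ 'n"
  assumes ij: "i \<noteq> j"
    and A: "A $ i $ i = q *\<^sub>R e" "A $ j $ j = - q *\<^sub>R e" "A $ i $ j = r *\<^sub>R e" "A $ j $ i = r *\<^sub>R e"
    and A0: "\<And>a b. a \<notin> {i, j} \<or> b \<notin> {i, j} \<Longrightarrow> A $ a $ b = 0"
  shows "\<exists>t s. conj_rot i j t A = s *\<^sub>R (coord_point i - coord_point j)"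
proof -
  obtain t' where "r * cos t' + (- q) * sin t' = 0"
    using ex_angle by blast
  then obtain t where t: "r * cos (2 * t) + (- q) * sin (2 * t) = 0"
    by (metis mult.commute nonzero_mult_div_cancel_right times_divide_eq_right zero_neq_numeral)
  let ?B = "conj_rot i j t A"
  define s where "s = q * cos (2 * t) + r * sin (2 * t)"
  have double: "cos (2 * t) = cos t * cos t - sin t * sin t" "sin (2 * t) = sin t * cos t + sin t * cos t"
    by (simp_all add: cos_double sin_double power2_eq_square)
  have off: "?B $ i $ j = (r * cos (2 * t) + (- q) * sin (2 * t)) *\<^sub>R e"
    "?B $ j $ i = (r * cos (2 * t) + (- q) * sin (2 * t)) *\<^sub>R e"
    unfolding double using ij A
    by (simp_all add: conj_rot_def rot_def algebra_simps) (simp_all add: ac_simps flip: scaleR_2)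
  have diag: "?B $ i $ i = s *\<^sub>R e" "?B $ j $ j = - s *\<^sub>R e"
    unfolding s_def double using ij A
    by (simp_all add: conj_rot_def rot_def algebra_simps) (simp_all add: ac_simps flip: scaleR_2)
  have zero: "?B $ a $ b = 0" if "a \<notin> {i, j} \<or> b \<notin> {i, j}" for a b
    using that A0 by (auto simp: conj_rot_def rot_def)
  have "?B $ a $ b = (s *\<^sub>R (coord_point i - coord_point j)) $ a $ b" for a b
    using off t diag zero [of a b] ij
    by (cases "a \<in> {i, j} \<and> b \<in> {i, j}") (auto simp: coord_point_def)
  then have "?B = s *\<^sub>R (coord_point i - coord_point j)"
    by (simp add: vec_eq_iff)
  then show ?thesis by blast
qed


section \<open>Conjugation by diagonal matrices\<close>

definition twist :: "('n \<Rightarrow> 'f) \<Rightarrow> 'f ^ 'n ^ 'n \<Rightarrow> 'f ^ 'n ^ 'n"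
  where "twist l X = (\<chi> a b. m (m (l a) (X $ a $ b)) (c (l b)))"

text \<open>
  The diagonals \<open>l\<close> for which \<open>X \<mapsto> diag l X (diag l)\<^sup>H\<close> preserves the projective space. Over an
  associative algebra all tuples of unit elements qualify, over the octonions only special ones.
\<close>

definition admissible :: "('n \<Rightarrow> 'f) \<Rightarrow> bool"
  where "admissible l \<longleftrightarrow> (\<forall>a. norm (l a) = 1) \<and>
    (\<forall>a x. m (m x (l a)) (c (l a)) = x) \<and> (\<forall>a x. m (l a) (m (c (l a)) x) = x) \<and>
    (\<forall>a b x. m (l a) (m x (c (l b))) = m (m (l a) x) (c (l b))) \<and>
    (\<forall>a k b x y. a \<noteq> k \<longrightarrow> k \<noteq> b \<longrightarrow> a \<noteq> b \<longrightarrow>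
      m (m (m (l a) x) (c (l k))) (m (m (l k) y) (c (l b))) = m (m (l a) (m x y)) (c (l b)))"

lemma twist_diagonal:
  assumes l: "admissible l" and X: "X \<in> proj_space m c e"
  shows "twist l X $ a $ a = X $ a $ a"
  using l by (simp add: twist_def diagonal [OF X] admissible_def m_simps)

text \<open>Idempotence is verified for each single product of entries. A diagonal factor is real
  and can be pulled out; for \<open>a = b\<close> the product is a squared norm; three distinct
  indices are the last clause of \<open>admissible\<close>.\<close>

lemma twist_in_proj_space:
  fixes X :: "'f ^ 'n::finite ^ 'n"
  assumes l: "admissible l" and X: "X \<in> proj_space m c e"
  shows "twist l X \<in> proj_space m c e"
proof -
  let ?Y = "twist l X"
  have norm_l: "norm (l a) = 1" for a
    using l by (simp add: admissible_def)
  have flex: "m (l a) (m x (c (l b))) = m (m (l a) x) (c (l b))" for a b x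
    using l by (simp add: admissible_def)
  have herm: "?Y $ a $ b = c (?Y $ b $ a)" for a b
    unfolding twist_def by (simp add: c_m flex flip: hermitian [OF X, of a b])
  have entry: "m (?Y $ a $ k) (?Y $ k $ b) = m (m (l a) (m (X $ a $ k) (X $ k $ b))) (c (l b))" for a k b
  proof -
    consider "a = k" | "k = b" | "a \<noteq> k" "a = b" | "a \<noteq> k" "k \<noteq> b" "a \<noteq> b" by blast
    then show ?thesis
    proof cases
      case 1
      then show ?thesis
        by (simp add: twist_diagonal [OF l X] diagonal [OF X] m_simps) (simp add: twist_def)
    next
      case 2
      then show ?thesis
        by (simp add: twist_diagonal [OF l X] diagonal [OF X] m_simps) (simp add: twist_def)
    next
      case 3
      have "m (?Y $ a $ k) (?Y $ k $ a) = (norm (X $ a $ k))\<^sup>2 *\<^sub>R e"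
        by (subst herm [of k a]) (simp add: twist_def norm_m norm_l)
      moreover have "m (X $ a $ k) (X $ k $ a) = (norm (X $ a $ k))\<^sup>2 *\<^sub>R e"
        by (subst hermitian [OF X, of k a]) simp
      ultimately show ?thesis
        using 3 by (simp add: m_simps norm_l)
    next
      case 4
      then show ?thesis
        using l by (simp add: twist_def admissible_def)
    qed
  qed
  have lin: "linear (\<lambda>x. m (m (l a) x) (c (l b)))" for a b
    by (simp add: linear_iff m_simps)
  have idem: "(\<Sum>k\<in>UNIV. m (?Y $ a $ k) (?Y $ k $ b)) = ?Y $ a $ b" for a b
    unfolding entry using linear_sum [OF lin [of a b], of "\<lambda>k. m (X $ a $ k) (X $ k $ b)" UNIV]
    by (simp add: idempotent [OF X] twist_def)
  have "(\<Sum>k\<in>UNIV. ?Y $ k $ k) = e"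
    by (simp add: twist_diagonal [OF l X] trace [OF X])
  then show ?thesis
    unfolding proj_space_def by (intro CollectI conjI allI herm idem)
qed

text \<open>The conjugate diagonal gives the inverse map, hence admissibility is required of it as
  well.\<close>

lemma linear_symmetry_twist:
  fixes l :: "'n::finite \<Rightarrow> 'f"
  assumes l: "admissible l" and cl: "admissible (\<lambda>a. c (l a))"
  shows "linear_symmetry (proj_space m c e :: ('f ^ 'n ^ 'n) set) (twist l)"
proof (rule linear_symmetryI)
  show "orthogonal_transformation (twist l)"
    unfolding orthogonal_transformation
  proof
    show "linear (twist l)"
      by (simp add: linear_iff twist_def vec_eq_iff m_simps)
    show "\<forall>X. norm (twist l X) = norm X"
    proof
      fix X
      have "(norm (twist l X))\<^sup>2 = (norm X)\<^sup>2"
        using l by (simp add: norm_matrix_power2 twist_def norm_m admissible_def)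
      then show "norm (twist l X) = norm X" by (simp add: power2_eq_iff_nonneg)
    qed
  qed
  show "twist l X \<in> proj_space m c e" if "X \<in> proj_space m c e" for X :: "'f ^ 'n ^ 'n"
    by (rule twist_in_proj_space [OF l that])
  show "\<exists>Y\<in>proj_space m c e. twist l Y = X" if "X \<in> proj_space m c e" for X :: "'f ^ 'n ^ 'n"
  proof
    show "twist (\<lambda>a. c (l a)) X \<in> proj_space m c e"
      by (rule twist_in_proj_space [OF cl that])
    have "m (m (l a) (m (m (c (l a)) x) (l b))) (c (l b)) = x" for a b x
      using l cl by (auto simp: admissible_def) metis
    then show "twist l (twist (\<lambda>a. c (l a)) X) = X"
      by (simp add: twist_def vec_eq_iff)
  qed
qed

lemma twist_coord_point: "admissible l \<Longrightarrow> twist l (coord_point k) = coord_point k"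
  by (auto simp: twist_def coord_point_def vec_eq_iff m_simps admissible_def)

end

section \<open>Transitivity on points and on chords of projective spaces\<close>

text \<open>Three distinct indices exhaust the type, so \<open>i\<close> and \<open>j\<close> occupy
  two of the three places. This splits the octonionic check of \<open>admissible\<close>.\<close>

lemma neq_cases_3:
  fixes i j a k b :: 3
  assumes "i \<noteq> j" "a \<noteq> k" "k \<noteq> b" "a \<noteq> b"
  obtains "a = i" "k = j" "b \<noteq> i" "b \<noteq> j" | "a = i" "b = j" "k \<noteq> i" "k \<noteq> j"
    | "k = i" "a = j" "b \<noteq> i" "b \<noteq> j" | "k = i" "b = j" "a \<noteq> i" "a \<noteq> j"
    | "b = i" "a = j" "k \<noteq> i" "k \<noteq> j" | "b = i" "k = j" "a \<noteq> i" "a \<noteq> j"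
proof -
  have "x = a \<or> x = k \<or> x = b" for x
    using assms exhaust_3 [of x] exhaust_3 [of a] exhaust_3 [of k] exhaust_3 [of b] by auto
  from this [of i] this [of j] show ?thesis
    using assms that by blast
qed

text \<open>The assumption \<open>ex_admissible\<close> supplies twists that multiply the entry at
  \<open>i\<close>, \<open>j\<close> by a prescribed unit element.\<close>

locale projective_symmetry = composition_algebra m c e
  for dim :: "'n::finite itself"
    and m :: "'f::euclidean_space \<Rightarrow> 'f \<Rightarrow> 'f" and c :: "'f \<Rightarrow> 'f" and e :: 'f +
  assumes card_ge_2: "CARD('n) \<ge> 2"
    and ex_admissible: "i \<noteq> j \<Longrightarrow> norm u = 1 \<Longrightarrow>
      \<exists>l :: 'n \<Rightarrow> 'f. admissible l \<and> admissible (\<lambda>a. c (l a)) \<and> l i = u \<and> l j = e"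
begin

abbreviation (input) Q :: "('f ^ 'n ^ 'n) set"
  where "Q \<equiv> proj_space m c e"

text \<open>A twist by the normalized conjugate of the entry makes it real. Fixed coordinate points
  and diagonal entries ensure that earlier normalizations survive.\<close>

lemma ex_real_entry:
  assumes X: "X \<in> Q" and ij: "i \<noteq> j"
  shows "\<exists>T. linear_symmetry Q T \<and> (\<forall>k. T (coord_point k) = coord_point k) \<and>
    (\<forall>k. diag_entry (T X) k = diag_entry X k) \<and> (\<exists>r. T X $ i $ j = r *\<^sub>R e)"
proof -
  obtain u r where u: "norm u = 1" "m u (X $ i $ j) = r *\<^sub>R e"
  proof (cases "X $ i $ j = 0")
    case True
    then show ?thesis using that [of e 0] by simp
  next
    case False
    show ?thesis
      by (rule that [of "(1 / norm (X $ i $ j)) *\<^sub>R c (X $ i $ j)" "norm (X $ i $ j)"])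
        (use False in \<open>simp_all add: m_simps power2_eq_square\<close>)
  qed
  obtain l :: "'n \<Rightarrow> 'f" where l: "admissible l" "admissible (\<lambda>a. c (l a))" "l i = u" "l j = e"
    using ex_admissible [OF ij u(1)] by blast
  show ?thesis
  proof (intro exI conjI allI)
    show "linear_symmetry Q (twist l)"
      by (rule linear_symmetry_twist [OF l(1,2)])
    show "twist l (coord_point k) = coord_point k" for k
      by (rule twist_coord_point [OF l(1)])
    show "diag_entry (twist l X) k = diag_entry X k" for k
      by (simp add: diag_entry_def twist_diagonal [OF l(1) X])
    show "twist l X $ i $ j = r *\<^sub>R e"
      by (simp add: twist_def l u)
  qed
qed

lemma linear_symmetry_in: "linear_symmetry Q T \<Longrightarrow> X \<in> Q \<Longrightarrow> T X \<in> Q"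
  by (auto simp: linear_symmetry_def)

text \<open>By induction, each \<open>j\<close> in \<open>S\<close> is cleared by making the entry
  at \<open>i\<close>, \<open>j\<close> real and rotating that plane. Only the pivot
  \<open>i\<close> and the index \<open>j\<close> change on the diagonal, so earlier zeros
  persist.\<close>

lemma ex_clear_diag_entries:
  assumes "finite S" "i \<notin> S" "X \<in> Q"
  shows "\<exists>T. linear_symmetry Q T \<and> (\<forall>k. k \<notin> insert i S \<longrightarrow> T (coord_point k) = coord_point k) \<and>
    (\<forall>k\<in>S. diag_entry (T X) k = 0) \<and>
    (\<forall>k. k \<notin> insert i S \<longrightarrow> diag_entry (T X) k = diag_entry X k)"
  using assms
proof (induction S rule: finite_induct)
  case empty
  show ?case by (rule exI [of _ "\<lambda>x. x"]) (simp add: linear_symmetry_id)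
next
  case (insert j S)
  then have ij: "i \<noteq> j" "i \<notin> S" by auto
  obtain T where T: "linear_symmetry Q T" "\<And>k. k \<notin> insert i S \<Longrightarrow> T (coord_point k) = coord_point k"
    "\<And>k. k \<in> S \<Longrightarrow> diag_entry (T X) k = 0"
    "\<And>k. k \<notin> insert i S \<Longrightarrow> diag_entry (T X) k = diag_entry X k"
    using insert.IH [OF ij(2) \<open>X \<in> Q\<close>] by blast
  have TX: "T X \<in> Q"
    using T(1) \<open>X \<in> Q\<close> by (rule linear_symmetry_in)
  obtain U r where U: "linear_symmetry Q U" "\<And>k. U (coord_point k) = coord_point k"
    "\<And>k. diag_entry (U (T X)) k = diag_entry (T X) k" "U (T X) $ i $ j = r *\<^sub>R e"
    using ex_real_entry [OF TX ij(1)] by blast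
  have UTX: "U (T X) \<in> Q"
    using U(1) TX by (rule linear_symmetry_in)
  obtain t where t: "diag_entry (conj_rot i j t (U (T X))) j = 0"
    using ex_conj_rot_diag_entry_0 [OF UTX ij(1) U(4)] ..
  have other: "diag_entry (conj_rot i j t Y) k = diag_entry Y k" if "k \<noteq> i" "k \<noteq> j" for k Y
    using that by (simp add: diag_entry_def conj_rot_def rot_def)
  show ?case
  proof (intro exI [of _ "conj_rot i j t \<circ> U \<circ> T"] conjI ballI allI impI)
    show "linear_symmetry Q (conj_rot i j t \<circ> U \<circ> T)"
      by (intro linear_symmetry_compose linear_symmetry_conj_rot T U ij)
    show "(conj_rot i j t \<circ> U \<circ> T) (coord_point k) = coord_point k"
      if "k \<notin> insert i (insert j S)" for k
      using that T(2) [of k] U(2) by (simp add: conj_rot_coord_point)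
    show "diag_entry ((conj_rot i j t \<circ> U \<circ> T) X) k = 0" if "k \<in> insert j S" for k
      using that t T(3) U(3) ij insert.hyps other by (cases "k = j"; cases "k = i") auto
    show "diag_entry ((conj_rot i j t \<circ> U \<circ> T) X) k = diag_entry X k"
      if "k \<notin> insert i (insert j S)" for k
      using that T(4) U(3) other by simp
  qed
qed

lemma ex_symmetry_to_coord_point:
  assumes "X \<in> Q"
  shows "\<exists>T. linear_symmetry Q T \<and> T X = coord_point i"
proof -
  obtain T where T: "linear_symmetry Q T" "\<And>k. k \<noteq> i \<Longrightarrow> diag_entry (T X) k = 0"
    using ex_clear_diag_entries [of "- {i}" i X] assms by auto
  then have "T X = coord_point i"
    by (intro coord_pointI linear_symmetry_in [OF T(1) assms])
  with T(1) show ?thesis by blast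
qed

lemma transitive_proj_space:
  assumes "X \<in> Q" "Y \<in> Q"
  shows "\<exists>T. linear_symmetry Q T \<and> T X = Y"
proof -
  \<comment> \<open>Here \<open>undefined\<close> is merely some index; both points are moved to the
    same coordinate point.\<close>
  obtain S where S: "linear_symmetry Q S" "S X = coord_point undefined"
    using ex_symmetry_to_coord_point assms by blast
  obtain T where T: "linear_symmetry Q T" "T Y = coord_point undefined"
    using ex_symmetry_to_coord_point assms by blast
  have "inj T"
    using T(1) by (simp add: linear_symmetry_def orthogonal_transformation_inj)
  then have "(inv T \<circ> S) X = Y"
    using S(2) T(2) by (metis comp_apply inv_f_f)
  with S T show ?thesis
    by (blast intro: linear_symmetry_compose linear_symmetry_inv)
qed

text \<open>First X goes to E_i. Symmetries fixing E_i then confine the image of Y to the block at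
  \<open>i\<close>, \<open>j\<close> and make it real. The difference has trace zero and is
  diagonalized by a rotation.\<close>

lemma transitive_chords_proj_space:
  assumes X: "X \<in> Q" and Y: "Y \<in> Q" and ij: "i \<noteq> j"
  shows "\<exists>T s. linear_symmetry Q T \<and> T (X - Y) = s *\<^sub>R (coord_point i - coord_point j)"
proof -
  obtain T where T: "linear_symmetry Q T" "T X = coord_point i"
    using ex_symmetry_to_coord_point X by blast
  have TY: "T Y \<in> Q" using T(1) Y by (rule linear_symmetry_in)
  obtain U where U: "linear_symmetry Q U" "U (coord_point i) = coord_point i"
    "\<And>k. k \<notin> {i, j} \<Longrightarrow> diag_entry (U (T Y)) k = 0"
    \<comment> \<open>The pivot is \<open>j\<close>, so that \<open>coord_point i\<close> stays
      fixed.\<close>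
    using ex_clear_diag_entries [of "- {i, j}" j "T Y"] TY ij by auto
  have UTY: "U (T Y) \<in> Q" using U(1) TY by (rule linear_symmetry_in)
  obtain V r where V: "linear_symmetry Q V" "V (coord_point i) = coord_point i"
    "\<And>k. diag_entry (V (U (T Y))) k = diag_entry (U (T Y)) k" "V (U (T Y)) $ i $ j = r *\<^sub>R e"
    using ex_real_entry [OF UTY ij] by blast
  define Z where "Z = V (U (T Y))"
  have Z: "Z \<in> Q" unfolding Z_def using V(1) UTY by (rule linear_symmetry_in)
  have Z0: "diag_entry Z k = 0" if "k \<notin> {i, j}" for k
    using that U(3) V(3) by (simp add: Z_def)
  define q where "q = diag_entry Z j"
  have "(\<Sum>k\<in>UNIV. diag_entry Z k) = diag_entry Z i + q"
    unfolding sum_split2 [OF ij] using Z0 by (simp add: q_def)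
  then have "diag_entry Z i = 1 - q"
    using sum_diag_entry [OF Z] by simp
  then have entries: "Z $ i $ i = (1 - q) *\<^sub>R e" "Z $ j $ j = q *\<^sub>R e"
      "Z $ i $ j = r *\<^sub>R e" "Z $ j $ i = r *\<^sub>R e"
    using diagonal [OF Z] V(4) hermitian [OF Z, of j i] by (simp_all add: q_def Z_def c_simps)
  have zero: "(coord_point i - Z) $ a $ b = 0" if "a \<notin> {i, j} \<or> b \<notin> {i, j}" for a b
    using that Z0 entry_eq_0 [OF Z, of a b] by (auto simp: coord_point_def)
  have "\<exists>t s. conj_rot i j t (coord_point i - Z) = s *\<^sub>R (coord_point i - coord_point j)"
    \<comment> \<open>As Z has diagonal entries 1 - q and q in the block, E_i - Z has q and
      -q.\<close>
    by (rule ex_conj_rot_diagonal [OF ij, of _ q "- r"])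
      (use ij zero entries in \<open>auto simp: coord_point_def algebra_simps\<close>)
  then obtain t s where ts: "conj_rot i j t (coord_point i - Z) = s *\<^sub>R (coord_point i - coord_point j)"
    by blast
  have lin: "linear T" "linear U" "linear V"
    using T(1) U(1) V(1) by (auto simp: linear_symmetry_def orthogonal_transformation_linear)
  have "(conj_rot i j t \<circ> V \<circ> U \<circ> T) (X - Y) = s *\<^sub>R (coord_point i - coord_point j)"
    using ts by (simp add: linear_diff [OF lin(1)] linear_diff [OF lin(2)] linear_diff [OF lin(3)]
        T U V Z_def)
  then show ?thesis
    by (intro exI [of _ "conj_rot i j t \<circ> V \<circ> U \<circ> T"] exI [of _ s] conjI linear_symmetry_compose
        linear_symmetry_conj_rot ij T U V)
qed

text \<open>With \<open>X\<close> moved to a coordinate point, the inner product is a diagonal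
  entry. It bounds distances by \<open>sqrt 2\<close>, which keeps the argument of
  \<open>arcsin\<close> in \<open>proj_dist\<close> at most 1.\<close>

lemma inner_nonneg:
  assumes "X \<in> Q" "Y \<in> Q"
  shows "X \<bullet> Y \<ge> 0"
proof -
  obtain T where T: "linear_symmetry Q T" "T X = coord_point undefined"
    using ex_symmetry_to_coord_point assms by blast
  then have "X \<bullet> Y = coord_point undefined \<bullet> T Y"
    by (metis linear_symmetry_def orthogonal_transformation_def)
  then show ?thesis
    using diag_entry_nonneg linear_symmetry_in [OF T(1) assms(2)] by (simp add: inner_coord_point)
qed

end

context projective_symmetry
begin

theorem chordal_proportional_proj_space:
  assumes "invariant_prob_measure Q proj_dist \<mu>"
  shows "chordal_proportional_sym_diff Q proj_dist \<mu> sin"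
proof -
  obtain i j :: 'n where ij: "i \<noteq> j"
    using card_ge_2 card_2_iff' [of "UNIV :: 'n set"] by (metis UNIV_I card_le_Suc0_iff_eq finite not_less_eq_eq numeral_2_eq_2)
  have dist: "(norm (X - Y))\<^sup>2 = 2 - 2 * (X \<bullet> Y)" if "X \<in> Q" "Y \<in> Q" for X Y
    using norm_proj_space [OF that(1)] norm_proj_space [OF that(2)]
    by (simp add: power2_norm_eq_inner inner_diff_left inner_diff_right inner_commute norm_eq_1)
  have le: "norm (X - Y) / sqrt 2 \<le> 1" if "X \<in> Q" "Y \<in> Q" for X Y
    using dist [OF that] inner_nonneg [OF that] by (simp add: real_le_rsqrt)
  interpret embedded_space Q proj_dist "1 / sqrt 2" 1 "coord_point i - coord_point j" \<mu>
  proof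
    show "compact Q" by (rule compact_proj_space)
    show "\<exists>X\<in>Q. \<exists>Y\<in>Q. X \<noteq> Y"
    proof (intro bexI)
      have "coord_point i $ i $ i \<noteq> coord_point j $ i $ i"
        using ij by (simp add: coord_point_def)
      then show "coord_point i \<noteq> coord_point j" by metis
    qed (rule coord_point_in_proj_space)+
    show "norm X = 1" if "X \<in> Q" for X
      by (rule norm_proj_space [OF that])
    show "proj_dist X Y \<in> {0..pi}" if "X \<in> Q" "Y \<in> Q" for X Y
    proof -
      have "-1 \<le> norm (X - Y) / sqrt 2" by (rule order_trans [of _ 0]) auto
      then show ?thesis
        using arcsin_bounded [of "norm (X - Y) / sqrt 2"]
          arcsin_le_arcsin [of 0 "norm (X - Y) / sqrt 2"] le [OF that]
        by (simp add: proj_dist_def)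
    qed
    show "cos (proj_dist X Y) = 1 - 2 * (1 / sqrt 2 * norm (X - Y))\<^sup>2" if "X \<in> Q" "Y \<in> Q" for X Y
      using le [OF that] order_trans [of "-1" 0 "norm (X - Y) / sqrt 2"]
      unfolding proj_dist_def cos_double_sin by simp
    show "\<exists>T. linear_symmetry Q T \<and> T X = Y" if "X \<in> Q" "Y \<in> Q" for X Y
      by (rule transitive_proj_space [OF that])
    show "\<exists>T s. linear_symmetry Q T \<and> T (X - Y) = s *\<^sub>R (coord_point i - coord_point j)"
      if "X \<in> Q" "Y \<in> Q" for X Y
      by (rule transitive_chords_proj_space [OF that ij])
  qed (use assms in auto)
  show ?thesis by (rule chordal_proportional)
qed

end

section \<open>Admissible diagonals for associative algebras and for octonions\<close>

text \<open>Every diagonal of unit elements is admissible here, in particular \<open>u\<close> at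
  \<open>i\<close> and \<open>e\<close> elsewhere.\<close>

lemma (in composition_algebra) projective_symmetry_associative:
  assumes assoc: "\<And>x y z. m (m x y) z = m x (m y z)" and "CARD('n::finite) \<ge> 2"
  shows "projective_symmetry TYPE('n) m c e"
proof
  have cancel: "m x (m (c x) y) = y" "m (c x) (m x y) = y" if "norm x = 1" for x y
    using that by (simp_all flip: assoc)
  have adm: "admissible l" if "\<And>a. norm (l a) = 1" for l :: "'n \<Rightarrow> 'f"
    using that by (simp add: admissible_def assoc cancel)
  show "\<exists>l :: 'n \<Rightarrow> 'f. admissible l \<and> admissible (\<lambda>a. c (l a)) \<and> l i = u \<and> l j = e"
    if "i \<noteq> j" "norm u = 1" for i j u
    using that by (intro exI [of _ "\<lambda>a. if a = i then u else e"] conjI adm) auto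
qed fact

text \<open>The three Moufang identities stand in for associativity. Expanded in complex
  coordinates, they are identities in a commutative ring.\<close>

lemma moufang_middle: "oct_mult (oct_mult u x) (oct_mult y u) = oct_mult (oct_mult u (oct_mult x y)) u"
  by (cases u; cases x; cases y) (simp add: oct_unfold algebra_simps split: prod.splits)

lemma moufang_left: "oct_mult (oct_mult (oct_mult u x) u) y = oct_mult u (oct_mult x (oct_mult u y))"
  by (cases u; cases x; cases y) (simp add: oct_unfold algebra_simps split: prod.splits)

lemma moufang_right: "oct_mult (oct_mult (oct_mult x u) y) u = oct_mult x (oct_mult (oct_mult u y) u)"
  by (cases u; cases x; cases y) (simp add: oct_unfold algebra_simps split: prod.splits)

lemma oct_flexible: "oct_mult u (oct_mult x u) = oct_mult (oct_mult u x) u"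
  by (cases u; cases x) (simp add: oct_unfold algebra_simps split: prod.splits)

lemma oct_flexible_cnj:
  "oct_mult u (oct_mult x (oct_cnj u)) = oct_mult (oct_mult u x) (oct_cnj u)"
  by (cases u; cases x) (simp add: oct_unfold algebra_simps split: prod.splits)

lemma
  shows oct_inverse_left: "oct_mult (oct_cnj u) (oct_mult u x) = (norm u)\<^sup>2 *\<^sub>R x"
    and oct_inverse_right: "oct_mult (oct_mult x u) (oct_cnj u) = (norm u)\<^sup>2 *\<^sub>R x"
proof -
  have *: "r *\<^sub>R x = ((complex_of_real r * fst (fst x), complex_of_real r * snd (fst x)),
      (complex_of_real r * fst (snd x), complex_of_real r * snd (snd x)))" for r
    by (simp add: prod_eq_iff scaleR_conv_of_real)
  show "oct_mult (oct_cnj u) (oct_mult u x) = (norm u)\<^sup>2 *\<^sub>R x"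
    unfolding * norm_power2_oct by (simp add: oct_unfold algebra_simps)
  show "oct_mult (oct_mult x u) (oct_cnj u) = (norm u)\<^sup>2 *\<^sub>R x"
    unfolding * norm_power2_oct by (simp add: oct_unfold algebra_simps)
qed

text \<open>
  With \<open>D = diag (u, 1, cnj u)\<close>, up to the order of the indices, the map \<open>X \<mapsto> D X (cnj D)\<close> of
  octonionic matrices is multiplicative off the diagonal: this is what the Moufang identities say.
\<close>

lemma projective_symmetry_oct: "projective_symmetry TYPE(3) oct_mult oct_cnj oct_one"
proof -
  interpret composition_algebra oct_mult oct_cnj oct_one
    by (rule composition_algebra_oct)
  have adm: "admissible (\<lambda>a. if a = i then u else if a = j then oct_one else oct_cnj u)"
    if u: "norm u = 1" and ij: "i \<noteq> j" for i j :: 3 and u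
  proof -
    have inv: "oct_mult (oct_cnj u) (oct_mult u x) = x" "oct_mult u (oct_mult (oct_cnj u) x) = x"
      "oct_mult (oct_mult x u) (oct_cnj u) = x" "oct_mult (oct_mult x (oct_cnj u)) u = x" for x
      using u oct_inverse_left [of u x] oct_inverse_left [of "oct_cnj u" x]
        oct_inverse_right [of x u] oct_inverse_right [of x "oct_cnj u"] by simp_all
    note flex = oct_flexible [of u] oct_flexible_cnj [of u] oct_flexible [of "oct_cnj u"]
      oct_flexible_cnj [of "oct_cnj u", simplified]
    define l where "l a = (if a = i then u else if a = j then oct_one else oct_cnj u)" for a
    \<comment> \<open>The place of the index \<open>j\<close>, where the diagonal is 1, selects the
      identity: middle for \<open>k = j\<close>, left for \<open>b = j\<close>, right for
      \<open>a = j\<close>.\<close>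
    have mult: "oct_mult (oct_mult (oct_mult (l a) x) (oct_cnj (l k))) (oct_mult (oct_mult (l k) y) (oct_cnj (l b))) =
        oct_mult (oct_mult (l a) (oct_mult x y)) (oct_cnj (l b))"
      if "a \<noteq> k" "k \<noteq> b" "a \<noteq> b" for a k b x y
      using ij that
    proof (cases rule: neq_cases_3)
      case 1
      then show ?thesis using ij by (simp add: l_def moufang_middle)
    next
      case 2
      then show ?thesis using ij by (simp add: l_def moufang_left inv)
    next
      case 3
      then show ?thesis using ij
        by (simp add: l_def) (simp add: inv flip: moufang_right)
    next
      case 4
      then show ?thesis using ij by (simp add: l_def moufang_left inv)
    next
      case 5
      then show ?thesis using ij
        by (simp add: l_def) (simp add: inv flip: moufang_right)
    next
      case 6
      then show ?thesis using ij by (simp add: l_def moufang_middle)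
    qed
    have "admissible l"
      unfolding admissible_def
    proof (intro conjI allI impI mult)
    qed (simp_all add: l_def u inv flex)
    then show ?thesis unfolding l_def .
  qed
  show ?thesis
  proof
    show "\<exists>l :: 3 \<Rightarrow> oct. admissible l \<and> admissible (\<lambda>a. oct_cnj (l a)) \<and> l i = u \<and> l j = oct_one"
      if "i \<noteq> j" "norm u = 1" for i j u
    proof (intro exI conjI)
      let ?l = "\<lambda>a. if a = i then u else if a = j then oct_one else oct_cnj u"
      show "admissible ?l" using that by (intro adm)
      \<comment> \<open>The conjugate diagonal has the same shape, with \<open>oct_cnj u\<close> for
        \<open>u\<close>.\<close>
      have "(\<lambda>a. oct_cnj (?l a)) =
          (\<lambda>a. if a = i then oct_cnj u else if a = j then oct_one else oct_cnj (oct_cnj u))"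
        by auto
      then show "admissible (\<lambda>a. oct_cnj (?l a))"
        using that by (simp only:) (intro adm, simp_all)
    qed (use that in auto)
  qed simp
qed

section \<open>The sphere, and the collected cases\<close>

text \<open>All orthogonal maps are symmetries and act transitively on vectors of equal norm, so any
  unit vector may serve as \<open>v\<^sub>0\<close>. The factor 1/2 comes from |x - y| = 2
  sin(\<theta>/2).\<close>

theorem chordal_proportional_sphere:
  assumes "invariant_prob_measure (sphere (0 :: real ^ 'k) 1) sphere_dist \<mu>"
  shows "chordal_proportional_sym_diff (sphere (0 :: real ^ 'k) 1) sphere_dist \<mu> sin"
proof -
  let ?S = "sphere (0 :: real ^ 'k) 1" and ?v = "axis undefined 1 :: real ^ 'k"
  have sym: "linear_symmetry ?S T" if T: "orthogonal_transformation T" for T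
  proof -
    have "T x = y" if "x = inv T y" for x y
      using that T by (simp add: orthogonal_transformation_surj surj_f_inv_f)
    then show ?thesis
      using T orthogonal_transformation_inv [OF T]
      by (intro linear_symmetryI) (auto simp: orthogonal_transformation intro!: bexI [of _ "inv T x" for x])
  qed
  interpret embedded_space ?S sphere_dist "1 / 2" 1 ?v \<mu>
  proof
    show "\<exists>x\<in>?S. \<exists>y\<in>?S. x \<noteq> y"
    proof (intro bexI)
      have "?v $ undefined \<noteq> (- ?v) $ undefined" by simp
      then show "?v \<noteq> - ?v" by metis
    qed (simp_all add: norm_axis_1)
    fix x y assume xy: "x \<in> ?S" "y \<in> ?S"
    then have "\<bar>x \<bullet> y\<bar> \<le> 1"
      using Cauchy_Schwarz_ineq2 [of x y] by simp
    then have bound: "- 1 \<le> x \<bullet> y" "x \<bullet> y \<le> 1" by auto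
    show "sphere_dist x y \<in> {0..pi}"
      using bound by (simp add: sphere_dist_def arccos_lbound arccos_ubound)
    have "(norm (x - y))\<^sup>2 = 2 - 2 * (x \<bullet> y)"
      using xy by (simp add: power2_norm_eq_inner inner_diff_left inner_diff_right inner_commute norm_eq_1)
    then show "cos (sphere_dist x y) = 1 - 2 * (1 / 2 * norm (x - y))\<^sup>2"
      using bound by (simp add: sphere_dist_def power_divide) (simp add: field_simps)
    show "\<exists>T. linear_symmetry ?S T \<and> T x = y"
      using orthogonal_transformation_exists [of x y] xy sym by (metis mem_sphere_0)
    show "\<exists>T s. linear_symmetry ?S T \<and> T (x - y) = s *\<^sub>R ?v"
    proof -
      have "norm (x - y) = norm (norm (x - y) *\<^sub>R ?v)"
        by (simp add: norm_axis_1)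
      then obtain T where "orthogonal_transformation T" "T (x - y) = norm (x - y) *\<^sub>R ?v"
        by (rule orthogonal_transformation_exists)
      then show ?thesis using sym by blast
    qed
  qed (use assms in auto)
  show ?thesis by (rule chordal_proportional)
qed

theorem theorem2p1:
  shows
    "(CARD('k::finite) \<ge> 2 \<longrightarrow>
       (\<forall>\<mu>. invariant_prob_measure (sphere (0 :: real ^ 'k) 1) sphere_dist \<mu> \<longrightarrow>
         chordal_proportional_sym_diff (sphere (0 :: real ^ 'k) 1) sphere_dist \<mu> sin)) \<and>
     (CARD('n::finite) \<ge> 3 \<longrightarrow>
       (\<forall>\<mu>. invariant_prob_measure (proj_space (*) id 1 :: (real ^ 'n ^ 'n) set) proj_dist \<mu> \<longrightarrow>
         chordal_proportional_sym_diff (proj_space (*) id 1 :: (real ^ 'n ^ 'n) set) proj_dist \<mu> sin) \<and>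
       (\<forall>\<mu>. invariant_prob_measure (proj_space (*) cnj 1 :: (complex ^ 'n ^ 'n) set) proj_dist \<mu> \<longrightarrow>
         chordal_proportional_sym_diff (proj_space (*) cnj 1 :: (complex ^ 'n ^ 'n) set) proj_dist \<mu> sin) \<and>
       (\<forall>\<mu>. invariant_prob_measure (proj_space quat_mult quat_cnj quat_one :: (quat ^ 'n ^ 'n) set) proj_dist \<mu> \<longrightarrow>
         chordal_proportional_sym_diff (proj_space quat_mult quat_cnj quat_one :: (quat ^ 'n ^ 'n) set) proj_dist \<mu> sin)) \<and>
     (\<forall>\<mu>. invariant_prob_measure (proj_space oct_mult oct_cnj oct_one :: (oct ^ 3 ^ 3) set) proj_dist \<mu> \<longrightarrow>
       chordal_proportional_sym_diff (proj_space oct_mult oct_cnj oct_one :: (oct ^ 3 ^ 3) set) proj_dist \<mu> sin)"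
proof (intro conjI impI allI)
  show "chordal_proportional_sym_diff (sphere (0 :: real ^ 'k) 1) sphere_dist \<mu> sin"
    if "invariant_prob_measure (sphere (0 :: real ^ 'k) 1) sphere_dist \<mu>" for \<mu>
    using that by (rule chordal_proportional_sphere)
next
  assume "CARD('n) \<ge> 3"
  then have card: "CARD('n) \<ge> 2" by simp
  interpret real: projective_symmetry "TYPE('n)" "(*)" id "1 :: real"
    by (rule composition_algebra.projective_symmetry_associative [OF composition_algebra_real _ card]) simp
  interpret complex: projective_symmetry "TYPE('n)" "(*)" cnj 1
    by (rule composition_algebra.projective_symmetry_associative [OF composition_algebra_complex _ card]) simp
  interpret quat: projective_symmetry "TYPE('n)" quat_mult quat_cnj quat_one
    by (rule composition_algebra.projective_symmetry_associative [OF composition_algebra_quat quat_assoc card])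
  show "chordal_proportional_sym_diff (proj_space (*) id 1 :: (real ^ 'n ^ 'n) set) proj_dist \<mu> sin"
    if "invariant_prob_measure (proj_space (*) id 1 :: (real ^ 'n ^ 'n) set) proj_dist \<mu>" for \<mu>
    using that by (rule real.chordal_proportional_proj_space)
  show "chordal_proportional_sym_diff (proj_space (*) cnj 1 :: (complex ^ 'n ^ 'n) set) proj_dist \<mu> sin"
    if "invariant_prob_measure (proj_space (*) cnj 1 :: (complex ^ 'n ^ 'n) set) proj_dist \<mu>" for \<mu>
    using that by (rule complex.chordal_proportional_proj_space)
  show "chordal_proportional_sym_diff (proj_space quat_mult quat_cnj quat_one :: (quat ^ 'n ^ 'n) set) proj_dist \<mu> sin"
    if "invariant_prob_measure (proj_space quat_mult quat_cnj quat_one :: (quat ^ 'n ^ 'n) set) proj_dist \<mu>" for \<mu>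
    using that by (rule quat.chordal_proportional_proj_space)
next
  interpret projective_symmetry "TYPE(3)" oct_mult oct_cnj oct_one
    by (rule projective_symmetry_oct)
  show "chordal_proportional_sym_diff (proj_space oct_mult oct_cnj oct_one :: (oct ^ 3 ^ 3) set) proj_dist \<mu> sin"
    if "invariant_prob_measure (proj_space oct_mult oct_cnj oct_one :: (oct ^ 3 ^ 3) set) proj_dist \<mu>" for \<mu>
    using that by (rule chordal_proportional_proj_space)
qed

end
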